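(* Let $d\geq1$, $\mathcal X=\{-1,1\}^d$, and let $p:\mathcal X\to(0,1)$ be a strictly positive probability distribution. Let $s=\delta\log p$ be the Glauber score, and let $$\beta_2=\max_{x\neq y\in\mathcal X}\frac{\|s(x)-s(y)\|_\infty}{\|x-y\|_1}.$$ Let $\eta>0$ be such that $x_is(x)_i\geq-\frac1{2\eta}$ for all $x\in\mathcal X$ and $i\in\{1,\dots,d\}$, and suppose $8d\beta_2\leq1$. Then the DUPS kernel $t_{\rm DUPS}$ with step-size parameter $\eta$ and score $s$ converges to its invariant probability measure $\hat p_{\rm DUPS}$ (that is, $t_{\rm DUPS}^n(\cdot|x)\to\hat p_{\rm DUPS}$ as $n\to\infty$ for every $x\in\mathcal X$), and $$\mathcal W(\hat p_{\rm DUPS},p)\leq\frac{d^3}{2}\,(1+e^{-1/\eta})^{d-1}\,e^{-1/\eta}.$$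
   Context: For $x\in\mathcal X$ and $u\in\{-1,1\}$, $(u,x_{-i})$ denotes the vector obtained from $x$ by setting its $i$-th coordinate to $u$ and keeping the other coordinates. The Glauber score $\delta\log p:\mathcal X\to\mathbb R^d$ is $[\delta\log p(x)]_i=\frac12\log p(1,x_{-i})-\frac12\log p(-1,x_{-i})$. For $\eta>0$, define kernels on $\mathcal X$ by $u(z|x)\propto\exp(x^\top z/\eta)$ (normalized over $z\in\mathcal X$) and $\hat v(x'|z)\propto\exp\big((z/\eta+s(z))^\top x'\big)$ (normalized over $x'\in\mathcal X$). The DUPS (discrete unadjusted proximal sampler) kernel is $t_{\rm DUPS}(x'|x)=\sum_{z\in\mathcal X}u(z|x)\hat v(x'|z)$, and $t_{\rm DUPS}^n$ denotes its $n$-step kernel. The Hamming loss is $\ell(x,y)=\sum_{i=1}^d\mathbf 1\{x_i\neq y_i\}$, and the Wasserstein distance between probability distributions $q,r$ on $\mathcal X$ is $\mathcal W(q,r)=\min\mathbb E[\ell(X,Y)]$, the minimum being over all couplings $(X,Y)$ with $X\sim q$, $Y\sim r$. *)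

theory Defs
  imports "HOL-Probability.Probability"
begin

definition hypercube :: "(real ^ 'd) set" where
  "hypercube = {x. \<forall>i. x $ i = -1 \<or> x $ i = 1}"

definition set_coord :: "'d \<Rightarrow> real \<Rightarrow> real ^ 'd \<Rightarrow> real ^ 'd" where
  "set_coord i u x = (\<chi> j. if j = i then u else x $ j)"

definition glauber_score :: "(real ^ 'd) pmf \<Rightarrow> real ^ 'd \<Rightarrow> real ^ 'd" where
  "glauber_score p x =
    (\<chi> i. 1 / 2 * ln (pmf p (set_coord i 1 x)) - 1 / 2 * ln (pmf p (set_coord i (-1) x)))"

definition l1_norm :: "real ^ 'd \<Rightarrow> real" where
  "l1_norm x = (\<Sum>i\<in>UNIV. \<bar>x $ i\<bar>)"

definition score_beta2 :: "(real ^ 'd \<Rightarrow> real ^ 'd) \<Rightarrow> real" where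
  "score_beta2 s =
    Max {infnorm (s x - s y) / l1_norm (x - y) |x y. x \<in> hypercube \<and> y \<in> hypercube \<and> x \<noteq> y}"

lemma finite_hypercube: "finite (hypercube :: (real ^ 'd) set)"
proof -
  have "(hypercube :: (real ^ 'd) set) \<subseteq> vec_lambda ` (UNIV \<rightarrow>\<^sub>E {-1, 1})"
  proof
    fix x :: "real ^ 'd" assume "x \<in> hypercube"
    then have "vec_nth x \<in> UNIV \<rightarrow>\<^sub>E {-1, 1}" by (auto simp: hypercube_def)
    then show "x \<in> vec_lambda ` (UNIV \<rightarrow>\<^sub>E {-1, 1})"
      by (metis image_eqI vec_nth_inverse)
  qed
  moreover have "finite (UNIV \<rightarrow>\<^sub>E {-1, 1} :: ('d \<Rightarrow> real) set)"
    by (intro finite_PiE) auto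
  ultimately show ?thesis by (meson finite_imageI finite_subset)
qed

lemma hypercube_not_empty: "hypercube \<noteq> {}"
proof -
  have "(\<chi> i. 1) \<in> hypercube" by (simp add: hypercube_def)
  then show ?thesis by blast
qed

definition gibbs_pmf :: "(real ^ 'd \<Rightarrow> real) \<Rightarrow> (real ^ 'd) pmf" where
  "gibbs_pmf h =
    embed_pmf (\<lambda>z. if z \<in> hypercube then exp (h z) / (\<Sum>w\<in>hypercube. exp (h w)) else 0)"

lemma pmf_gibbs_pmf:
  "pmf (gibbs_pmf h) z =
    (if z \<in> hypercube then exp (h z) / (\<Sum>w\<in>hypercube. exp (h w)) else 0)"
proof -
  let ?Z = "\<Sum>w\<in>hypercube. exp (h w)"
  let ?f = "\<lambda>z. if z \<in> hypercube then exp (h z) / ?Z else 0"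
  have pos: "?Z > 0"
    by (intro sum_pos) (auto simp: finite_hypercube hypercube_not_empty)
  have nonneg: "?f x \<ge> 0" for x using pos by simp
  have "(\<integral>\<^sup>+x. ennreal (?f x) \<partial>count_space UNIV) = (\<Sum>x\<in>hypercube. ennreal (?f x))"
    by (rule nn_integral_count_space') (auto simp: finite_hypercube)
  also have "\<dots> = ennreal (\<Sum>x\<in>hypercube. ?f x)"
    by (rule sum_ennreal) (rule nonneg)
  also have "(\<Sum>x\<in>hypercube. ?f x) = 1"
    using pos by (simp add: sum_divide_distrib [symmetric])
  finally show ?thesis unfolding gibbs_pmf_def
    by (subst pmf_embed_pmf) (use nonneg in \<open>simp_all only: refl ennreal_1\<close>)
qed

lemma set_pmf_gibbs_pmf: "set_pmf (gibbs_pmf h) = hypercube"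
proof -
  have "(\<Sum>w\<in>hypercube. exp (h w)) > 0"
    by (intro sum_pos) (auto simp: finite_hypercube hypercube_not_empty)
  then show ?thesis by (auto simp: set_pmf_iff pmf_gibbs_pmf split: if_splits)
qed

definition dups_u :: "real \<Rightarrow> real ^ 'd \<Rightarrow> (real ^ 'd) pmf" where
  "dups_u \<eta> x = gibbs_pmf (\<lambda>z. (x \<bullet> z) / \<eta>)"

definition dups_v :: "real \<Rightarrow> (real ^ 'd \<Rightarrow> real ^ 'd) \<Rightarrow> real ^ 'd \<Rightarrow> (real ^ 'd) pmf" where
  "dups_v \<eta> s z = gibbs_pmf (\<lambda>x'. (z /\<^sub>R \<eta> + s z) \<bullet> x')"

definition dups :: "real \<Rightarrow> (real ^ 'd \<Rightarrow> real ^ 'd) \<Rightarrow> real ^ 'd \<Rightarrow> (real ^ 'd) pmf" where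
  "dups \<eta> s x = bind_pmf (dups_u \<eta> x) (dups_v \<eta> s)"

lemma pmf_dups:
  "pmf (dups \<eta> s x) x' = (\<Sum>z\<in>hypercube. pmf (dups_u \<eta> x) z * pmf (dups_v \<eta> s z) x')"
  unfolding dups_def pmf_bind
  by (subst integral_measure_pmf_real [where A = hypercube])
     (auto simp: finite_hypercube dups_u_def set_pmf_gibbs_pmf mult.commute)

primrec kernel_power :: "('a \<Rightarrow> 'a pmf) \<Rightarrow> nat \<Rightarrow> 'a \<Rightarrow> 'a pmf" where
  "kernel_power t 0 x = return_pmf x"
| "kernel_power t (Suc n) x = bind_pmf (kernel_power t n x) t"

definition invariant_pmf :: "(real ^ 'd \<Rightarrow> (real ^ 'd) pmf) \<Rightarrow> (real ^ 'd) pmf \<Rightarrow> bool" where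
  "invariant_pmf t q \<longleftrightarrow> set_pmf q \<subseteq> hypercube \<and> bind_pmf q t = q"

definition hamming :: "real ^ 'd \<Rightarrow> real ^ 'd \<Rightarrow> real" where
  "hamming x y = (\<Sum>i\<in>UNIV. of_bool (x $ i \<noteq> y $ i))"

definition couplings :: "'a pmf \<Rightarrow> 'b pmf \<Rightarrow> ('a \<times> 'b) pmf set" where
  "couplings q r = {c. map_pmf fst c = q \<and> map_pmf snd c = r}"

text \<open>The infimum is a minimum for distributions on the hypercube, as shown by
  \<open>wasserstein_attained\<close>.\<close>

definition wasserstein :: "(real ^ 'd) pmf \<Rightarrow> (real ^ 'd) pmf \<Rightarrow> real" where
  "wasserstein q r =
    (INF c\<in>couplings q r. measure_pmf.expectation c (\<lambda>(x, y). hamming x y))"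

lemma wasserstein_attained:
  fixes q r :: "(real ^ 'd) pmf"
  assumes q: "set_pmf q \<subseteq> hypercube" and r: "set_pmf r \<subseteq> hypercube"
  obtains c where "c \<in> couplings q r"
    and "wasserstein q r = measure_pmf.expectation c (\<lambda>(x, y). hamming x y)"
    and "\<And>c'. c' \<in> couplings q r \<Longrightarrow>
      wasserstein q r \<le> measure_pmf.expectation c' (\<lambda>(x, y). hamming x y)"
proof -
  let ?X = "hypercube :: (real ^ 'd) set"
  let ?S = "?X \<times> ?X"
  let ?E = "\<lambda>c. measure_pmf.expectation c (\<lambda>(x, y). hamming x y)"
  define cost :: "((real ^ 'd) \<times> (real ^ 'd) \<Rightarrow> real) \<Rightarrow> real"
    where "cost f = (\<Sum>z\<in>?S. f z * (case z of (x, y) \<Rightarrow> hamming x y))" for f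
  define B :: "((real ^ 'd) \<times> (real ^ 'd) \<Rightarrow> real) set"
    where "B = PiE UNIV (\<lambda>z. if z \<in> ?S then {0..1} else {0})"
  define K where "K = B \<inter> ((\<Inter>a\<in>?X. {f. (\<Sum>b\<in>?X. f (a, b)) = pmf q a}) \<inter>
    (\<Inter>b\<in>?X. {f. (\<Sum>a\<in>?X. f (a, b)) = pmf r b}))"
  have finS: "finite ?S" by (simp add: finite_hypercube)
  have cont: "continuous_on A (\<lambda>f :: (real ^ 'd) \<times> (real ^ 'd) \<Rightarrow> real. f z)" for A z
    by (rule continuous_on_subset [OF continuous_on_product_coordinates]) simp
  have "compactin (product_topology (\<lambda>_. euclidean) UNIV) B"
    unfolding B_def compactin_PiE by auto
  then have "compact B"
    by (simp add: euclidean_product_topology)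
  moreover have "closed ((\<Inter>a\<in>?X. {f. (\<Sum>b\<in>?X. f (a, b)) = pmf q a}) \<inter>
    (\<Inter>b\<in>?X. {f. (\<Sum>a\<in>?X. f (a, b)) = pmf r b}))"
    by (intro closed_Int closed_INT ballI closed_Collect_eq continuous_intros cont)
  ultimately have "compact K" unfolding K_def by (rule compact_Int_closed)
  have supp: "set_pmf c \<subseteq> ?S" if "c \<in> couplings q r" for c
    using that q r by (fastforce simp: couplings_def)
  have E: "?E c = cost (pmf c)" if "set_pmf c \<subseteq> ?S" for c
    unfolding cost_def
    by (subst integral_measure_pmf_real [OF finS]) (use that in \<open>auto simp: mult.commute\<close>)
  have marg: "pmf (map_pmf fst c) a = (\<Sum>b\<in>?X. pmf c (a, b))"
      "pmf (map_pmf snd c) a = (\<Sum>b\<in>?X. pmf c (b, a))"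
    if c: "set_pmf c \<subseteq> ?S" for c a
  proof -
    have "pmf (map_pmf fst c) a = measure c ((Pair a) ` ?X)"
      unfolding pmf_map by (rule measure_pmf.finite_measure_eq_AE)
        (use c in \<open>auto simp: AE_measure_pmf_iff\<close>)
    then show "pmf (map_pmf fst c) a = (\<Sum>b\<in>?X. pmf c (a, b))"
      by (simp add: measure_measure_pmf_finite finite_hypercube sum.reindex inj_on_def)
    have "pmf (map_pmf snd c) a = measure c ((\<lambda>b. (b, a)) ` ?X)"
      unfolding pmf_map by (rule measure_pmf.finite_measure_eq_AE)
        (use c in \<open>auto simp: AE_measure_pmf_iff\<close>)
    then show "pmf (map_pmf snd c) a = (\<Sum>b\<in>?X. pmf c (b, a))"
      by (simp add: measure_measure_pmf_finite finite_hypercube sum.reindex inj_on_def)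
  qed
  have to_K: "pmf c \<in> K" if c: "c \<in> couplings q r" for c
  proof -
    have "pmf c \<in> B"
      unfolding B_def PiE_iff using supp [OF c] by (auto simp: pmf_le_1 pmf_eq_0_set_pmf)
    moreover have "(\<Sum>b\<in>?X. pmf c (a, b)) = pmf q a" "(\<Sum>b\<in>?X. pmf c (b, a)) = pmf r a" for a
      using marg [OF supp [OF c], of a] c by (simp_all add: couplings_def)
    ultimately show ?thesis unfolding K_def by blast
  qed
  have from_K: "\<exists>c\<in>couplings q r. pmf c = f" if f: "f \<in> K" for f
  proof -
    have fB: "f z \<in> (if z \<in> ?S then {0..1} else {0})" for z
      using f unfolding K_def B_def PiE_iff by blast
    have nonneg: "f z \<ge> 0" for z using fB [of z] by (simp split: if_splits)
    have out: "f z = 0" if "z \<notin> ?S" for z using fB [of z] that by (simp split: if_splits)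
    have "(\<integral>\<^sup>+z. ennreal (f z) \<partial>count_space UNIV) = (\<Sum>z\<in>?S. ennreal (f z))"
      by (rule nn_integral_count_space') (use out finS in auto)
    also have "\<dots> = ennreal (\<Sum>z\<in>?S. f z)" by (rule sum_ennreal) (rule nonneg)
    also have "(\<Sum>z\<in>?S. f z) = (\<Sum>a\<in>?X. pmf q a)"
      using f sum.cartesian_product' [of f ?X ?X] by (simp add: K_def)
    also have "\<dots> = 1" by (rule sum_pmf_eq_1) (use q finite_hypercube in auto)
    finally have pmf_f: "pmf (embed_pmf f) = f"
      by (intro ext pmf_embed_pmf) (use nonneg in auto)
    have S: "set_pmf (embed_pmf f) \<subseteq> ?S"
      unfolding set_pmf_eq pmf_f using out by blast
    have "map_pmf fst (embed_pmf f) = q"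
    proof (rule pmf_eqI)
      fix a show "pmf (map_pmf fst (embed_pmf f)) a = pmf q a"
      proof (cases "a \<in> ?X")
        case True
        then show ?thesis using marg(1) [OF S, of a] f by (simp add: pmf_f K_def)
      next
        case False
        then have "pmf q a = 0" using q by (auto simp: pmf_eq_0_set_pmf)
        moreover have "pmf (map_pmf fst (embed_pmf f)) a = 0"
          unfolding marg(1) [OF S] pmf_f using out False by (intro sum.neutral) auto
        ultimately show ?thesis by simp
      qed
    qed
    moreover have "map_pmf snd (embed_pmf f) = r"
    proof (rule pmf_eqI)
      fix a show "pmf (map_pmf snd (embed_pmf f)) a = pmf r a"
      proof (cases "a \<in> ?X")
        case True
        then show ?thesis using marg(2) [OF S, of a] f by (simp add: pmf_f K_def)
      next
        case False
        then have "pmf r a = 0" using r by (auto simp: pmf_eq_0_set_pmf)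
        moreover have "pmf (map_pmf snd (embed_pmf f)) a = 0"
          unfolding marg(2) [OF S] pmf_f using out False by (intro sum.neutral) auto
        ultimately show ?thesis by simp
      qed
    qed
    ultimately show ?thesis using pmf_f by (auto simp: couplings_def)
  qed
  have "pair_pmf q r \<in> couplings q r"
    by (simp add: couplings_def map_fst_pair_pmf map_snd_pair_pmf)
  then have "K \<noteq> {}" using to_K by blast
  moreover have "continuous_on K cost" unfolding cost_def
    by (intro continuous_intros cont)
  ultimately obtain f where f: "f \<in> K" "\<And>g. g \<in> K \<Longrightarrow> cost f \<le> cost g"
    using continuous_attains_inf [OF \<open>compact K\<close>] by blast
  from from_K [OF f(1)] obtain c where c: "c \<in> couplings q r" "pmf c = f" by blast
  have min: "?E c \<le> ?E c'" if "c' \<in> couplings q r" for c'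
    using f(2) [OF to_K [OF that]] E [OF supp [OF that]] E [OF supp [OF c(1)]] c(2) by simp
  have "wasserstein q r = ?E c"
    unfolding wasserstein_def by (intro antisym cINF_greatest cINF_lower bdd_belowI2 [where m = "?E c"]) (use c(1) min in auto)
  then show ?thesis using that c(1) min by metis
qed

end

theory Submission
  imports Defs
begin

text \<open>Replacing the DUPS backward kernel by the exact conditional law of \<open>x\<close> given \<open>z\<close>,
  proportional to \<open>p(x) exp(x\<^sup>T z/\<eta>)\<close>, gives a kernel that leaves \<open>p\<close> invariant. One
  step of DUPS from \<open>x\<close> and one exact step from \<open>y\<close> are coupled by using the same sign flips in
  the forward move and a sweep of optimally coupled single-site updates in the backward move. Let
  \<open>F\<^sub>j\<close> be the largest probability with which \<open>dups_v\<close> flips coordinate \<open>j\<close>; all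
  \<open>F\<^sub>j\<close> are at most \<open>\<epsilon> = 1/(1 + e\<^bsup>1/\<eta>\<^esup>)\<close>, by the condition on the step size. In the
  distance \<open>D\<close> that gives coordinate \<open>j\<close> the weight \<open>1/F\<^sub>j\<close>, the smoothness of the score
  makes the coupled step satisfy \<open>E D' \<le> D - \<ell>/d + (d - 1)\<epsilon>/2\<close>, where \<open>\<ell>\<close> is the
  Hamming distance. The coupled step maps couplings of the two invariant laws to such couplings,
  so \<open>E D\<close> cannot decrease by a fixed amount every time, and the Wasserstein distance is at
  most \<open>d (d - 1)\<epsilon>/2\<close>.\<close>

section \<open>Finitely supported distributions\<close>

lemma pmf_bind_finite:
  assumes "finite S" "set_pmf q \<subseteq> S"
  shows "pmf (bind_pmf q f) y = (\<Sum>z\<in>S. pmf q z * pmf (f z) y)"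
  unfolding pmf_bind
  by (subst integral_measure_pmf_real[OF assms(1)]) (use assms(2) in \<open>auto simp: mult.commute\<close>)

lemma expectation_mono_finite:
  fixes f g :: "'a \<Rightarrow> real"
  assumes "finite (set_pmf c)" "\<And>x. x \<in> set_pmf c \<Longrightarrow> f x \<le> g x"
  shows "measure_pmf.expectation c f \<le> measure_pmf.expectation c g"
  by (intro integral_mono_AE integrable_measure_pmf_finite assms(1))
     (use assms(2) in \<open>simp add: AE_measure_pmf_iff\<close>)

lemma expectation_cong_pmf:
  fixes f g :: "'a \<Rightarrow> real"
  assumes "\<And>x. x \<in> set_pmf c \<Longrightarrow> f x = g x"
  shows "measure_pmf.expectation c f = measure_pmf.expectation c g"
  by (intro integral_cong_AE) (use assms in \<open>simp_all add: AE_measure_pmf_iff\<close>)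

lemma expectation_bind_finite:
  fixes h :: "'b \<Rightarrow> real"
  assumes "finite (set_pmf p)" "\<And>x. x \<in> set_pmf p \<Longrightarrow> finite (set_pmf (f x))"
  shows "measure_pmf.expectation (bind_pmf p f) h =
    measure_pmf.expectation p (\<lambda>x. measure_pmf.expectation (f x) h)"
  using pmf_expectation_bind[OF assms(1) assms(2) order_refl, where h = h]
  by (subst integral_measure_pmf_real[OF assms(1)]) (auto simp: mult.commute)

lemma expectation_sum_finite:
  fixes f :: "'i \<Rightarrow> 'a \<Rightarrow> real"
  assumes "finite (set_pmf c)"
  shows "measure_pmf.expectation c (\<lambda>x. \<Sum>i\<in>I. f i x) =
    (\<Sum>i\<in>I. measure_pmf.expectation c (f i))"
  by (rule Bochner_Integration.integral_sum) (rule integrable_measure_pmf_finite[OF assms])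

section \<open>Couplings of finitely supported laws\<close>

lemma set_pmf_coupling:
  assumes "c \<in> couplings q r"
  shows "set_pmf c \<subseteq> set_pmf q \<times> set_pmf r"
proof
  fix z assume z: "z \<in> set_pmf c"
  then have "fst z \<in> set_pmf (map_pmf fst c)" "snd z \<in> set_pmf (map_pmf snd c)" by auto
  then show "z \<in> set_pmf q \<times> set_pmf r" using assms
    by (simp_all only: couplings_def mem_Collect_eq mem_Times_iff)
qed

lemma finite_set_pmf_coupling:
  assumes "c \<in> couplings q r" "finite (set_pmf q)" "finite (set_pmf r)"
  shows "finite (set_pmf c)"
  using set_pmf_coupling[OF assms(1)] assms(2,3) by (meson finite_SigmaI finite_subset)

lemma pair_pmf_couplings: "pair_pmf q r \<in> couplings q r"
  by (simp add: couplings_def map_fst_pair_pmf map_snd_pair_pmf)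

text \<open>Composes a coupling of initial laws with couplings of the transitions, one for each pair
  of states in the support. Both the sweep over the coordinates and the joint step of the two chains
  are built this way.\<close>

lemma bind_pmf_couplings:
  assumes c: "c \<in> couplings q r"
    and k: "\<And>x y. (x, y) \<in> set_pmf c \<Longrightarrow> k (x, y) \<in> couplings (f x) (g y)"
  shows "bind_pmf c k \<in> couplings (bind_pmf q f) (bind_pmf r g)"
proof -
  have "map_pmf fst (bind_pmf c k) = bind_pmf c (\<lambda>z. f (fst z))"
    unfolding map_bind_pmf
    by (intro bind_pmf_cong refl) (use k in \<open>auto simp: couplings_def\<close>)
  also have "\<dots> = bind_pmf (map_pmf fst c) f" by (simp add: bind_map_pmf)
  finally have 1: "map_pmf fst (bind_pmf c k) = bind_pmf q f"
    using c by (simp add: couplings_def)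
  have "map_pmf snd (bind_pmf c k) = bind_pmf c (\<lambda>z. g (snd z))"
    unfolding map_bind_pmf
    by (intro bind_pmf_cong refl) (use k in \<open>auto simp: couplings_def\<close>)
  also have "\<dots> = bind_pmf (map_pmf snd c) g" by (simp add: bind_map_pmf)
  finally have 2: "map_pmf snd (bind_pmf c k) = bind_pmf r g"
    using c by (simp add: couplings_def)
  from 1 2 show ?thesis by (simp add: couplings_def)
qed

lemma expectation_coupling_snd:
  fixes f :: "'b \<Rightarrow> real"
  assumes "c \<in> couplings q r"
  shows "measure_pmf.expectation c (\<lambda>z. f (snd z)) = measure_pmf.expectation r f"
  using assms integral_map_pmf[of snd c f] by (simp add: couplings_def)

text \<open>Monotone coupling: the second bit is drawn first, and the first bit is a thinning of it
  with retention probability \<open>a / b\<close>. The bits then differ only if the first is false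
  and the second true.\<close>

lemma bernoulli_coupling_le:
  assumes "0 \<le> a" "a \<le> b" "b \<le> (1::real)"
  shows "\<exists>c\<in>couplings (bernoulli_pmf a) (bernoulli_pmf b).
    measure_pmf.expectation c (\<lambda>(x, y). of_bool (x \<noteq> y)) = b - a"
proof (cases "b = 0")
  case True
  then have "a = 0" using assms by simp
  have "map_pmf (\<lambda>x. (x, x)) (bernoulli_pmf b) \<in> couplings (bernoulli_pmf a) (bernoulli_pmf b)"
    using True \<open>a = 0\<close> by (simp add: couplings_def map_pmf_comp)
  moreover have "measure_pmf.expectation (map_pmf (\<lambda>x. (x, x)) (bernoulli_pmf b))
      (\<lambda>(x, y). of_bool (x \<noteq> y) :: real) = b - a"
    using True \<open>a = 0\<close> by simp
  ultimately show ?thesis by blast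
next
  case False
  then have b: "0 < b" using assms by simp
  have ab: "0 \<le> a / b" "a / b \<le> 1" using assms b by auto
  define k where "k y = (if y then map_pmf (\<lambda>x. (x, True)) (bernoulli_pmf (a / b))
    else return_pmf (False, False))" for y
  define c where "c = bind_pmf (bernoulli_pmf b) k"
  have "map_pmf snd c = bind_pmf (bernoulli_pmf b) return_pmf"
    unfolding c_def map_bind_pmf
    by (intro bind_pmf_cong refl) (simp add: k_def map_pmf_comp map_pmf_const)
  then have 2: "map_pmf snd c = bernoulli_pmf b" by (simp add: bind_return_pmf')
  have fst_k: "map_pmf fst (k y) = (if y then bernoulli_pmf (a / b) else return_pmf False)" for y
    by (simp add: k_def map_pmf_comp)
  have 1: "map_pmf fst c = bernoulli_pmf a"
  proof (rule pmf_eqI)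
    fix x show "pmf (map_pmf fst c) x = pmf (bernoulli_pmf a) x"
      using assms b ab unfolding c_def map_bind_pmf fst_k pmf_bind
      by (cases x) (auto simp: field_simps)
  qed
  have "finite (set_pmf (k y))" for y
    by (simp add: k_def)
  then have "measure_pmf.expectation c (\<lambda>(x, y). of_bool (x \<noteq> y) :: real) =
     measure_pmf.expectation (bernoulli_pmf b)
       (\<lambda>y. measure_pmf.expectation (k y) (\<lambda>(x, y). of_bool (x \<noteq> y)))"
    unfolding c_def by (intro expectation_bind_finite) auto
  also have "\<dots> = b * (1 - a / b)"
    using assms ab b by (simp add: k_def)
  also have "\<dots> = b - a" using b by (simp add: field_simps)
  finally show ?thesis using 1 2 by (auto simp: couplings_def)
qed

lemma bernoulli_coupling:
  assumes "0 \<le> a" "a \<le> 1" "0 \<le> b" "b \<le> (1::real)"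
  shows "\<exists>c\<in>couplings (bernoulli_pmf a) (bernoulli_pmf b).
    measure_pmf.expectation c (\<lambda>(x, y). of_bool (x \<noteq> y)) = \<bar>a - b\<bar>"
proof (cases "a \<le> b")
  case True
  then show ?thesis using bernoulli_coupling_le[of a b] assms by auto
next
  case False
  then obtain c where c: "c \<in> couplings (bernoulli_pmf b) (bernoulli_pmf a)"
    "measure_pmf.expectation c (\<lambda>(x, y). of_bool (x \<noteq> y)) = a - b"
    using bernoulli_coupling_le[of b a] assms by auto
  have "map_pmf prod.swap c \<in> couplings (bernoulli_pmf a) (bernoulli_pmf b)"
    using c(1) by (simp add: couplings_def map_pmf_comp)
  moreover have "measure_pmf.expectation (map_pmf prod.swap c) (\<lambda>(x, y). of_bool (x \<noteq> y)) = \<bar>a - b\<bar>"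
    unfolding integral_map_pmf prod.swap_def case_prod_unfold fst_conv snd_conv
    using c(2) False by (simp add: case_prod_unfold eq_commute[of "snd _"])
  ultimately show ?thesis by blast
qed

section \<open>Convergence of positive kernels on a finite set\<close>

text \<open>\<open>kernel_power\<close> appends new steps at the end. The oscillation argument needs
  the first step split off, so that a function of the starting point is averaged against
  \<open>t x\<close>.\<close>

lemma kernel_power_Suc_left: "kernel_power t (Suc n) x = bind_pmf (t x) (kernel_power t n)"
proof (induction n)
  case 0
  have "kernel_power t 0 = return_pmf" by (simp add: fun_eq_iff)
  then show ?case by (simp add: bind_return_pmf bind_return_pmf')
next
  case (Suc n)
  have "kernel_power t (Suc (Suc n)) x = bind_pmf (kernel_power t (Suc n) x) t" by simp
  also have "\<dots> = bind_pmf (t x) (\<lambda>y. bind_pmf (kernel_power t n y) t)"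
    unfolding Suc by (simp add: bind_assoc_pmf)
  also have "(\<lambda>y. bind_pmf (kernel_power t n y) t) = kernel_power t (Suc n)" by (simp add: fun_eq_iff)
  finally show ?case .
qed

lemma bind_kernel_power_invariant:
  "bind_pmf q t = q \<Longrightarrow> bind_pmf q (kernel_power t n) = q"
proof (induction n)
  case 0
  have "kernel_power t 0 = return_pmf" by (simp add: fun_eq_iff)
  then show ?case by (simp add: bind_return_pmf')
next
  case (Suc n)
  then show ?case by (simp add: bind_assoc_pmf[symmetric])
qed

text \<open>Doeblin's argument: averaging against a kernel with all entries at least \<open>\<delta>\<close> shrinks the
  oscillation of a function by the factor \<open>1 - \<delta>\<close>.\<close>

lemma positive_kernel_converges:
  fixes t :: "'a \<Rightarrow> 'a pmf"
  assumes S: "finite S" "S \<noteq> {}" and t: "\<And>x. x \<in> S \<Longrightarrow> set_pmf (t x) = S"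
  shows "\<exists>\<pi>. (\<forall>q. set_pmf q \<subseteq> S \<and> bind_pmf q t = q \<longleftrightarrow> q = \<pi>) \<and>
    (\<forall>x\<in>S. \<forall>y\<in>S. (\<lambda>n. pmf (kernel_power t n x) y) \<longlonglongrightarrow> pmf \<pi> y)"
proof -
  define P where "P n x y = pmf (kernel_power t n x) y" for n x y
  have supp: "set_pmf (kernel_power t n x) \<subseteq> S" if "x \<in> S" for n x
    using that t by (induction n) auto
  note pmf_bind_S = pmf_bind_finite[OF S(1)]
  have left: "P (Suc n) x y = (\<Sum>z\<in>S. pmf (t x) z * P n z y)" if "x \<in> S" for n x y
    unfolding P_def kernel_power_Suc_left by (rule pmf_bind_S) (use t that in auto)
  have right: "P (Suc n) x y = (\<Sum>z\<in>S. P n x z * pmf (t z) y)" if "x \<in> S" for n x y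
    unfolding P_def kernel_power.simps by (rule pmf_bind_S) (use supp that in auto)
  have sum1: "(\<Sum>z\<in>S. pmf (t x) z) = 1" if "x \<in> S" for x
    by (rule sum_pmf_eq_1) (use S t that in auto)
  \<comment> \<open>A minimum of finitely many positive transition probabilities, hence
    positive.\<close>
  define \<delta> where "\<delta> = Min ((\<lambda>(x, y). pmf (t x) y) ` (S \<times> S))"
  have finSS: "finite ((\<lambda>(x, y). pmf (t x) y) ` (S \<times> S))" "(\<lambda>(x, y). pmf (t x) y) ` (S \<times> S) \<noteq> {}"
    using S by auto
  have "\<delta> \<in> (\<lambda>(x, y). pmf (t x) y) ` (S \<times> S)"
    unfolding \<delta>_def by (rule Min_in[OF finSS])
  then have \<delta>pos: "\<delta> > 0" using t by (auto simp: pmf_positive_iff)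
  have \<delta>le: "\<delta> \<le> pmf (t x) y" if "x \<in> S" "y \<in> S" for x y
    unfolding \<delta>_def by (rule Min_le[OF finSS(1)]) (use that in auto)
  obtain x0 where x0: "x0 \<in> S" using S by blast
  have \<delta>1: "\<delta> \<le> 1" using \<delta>le[OF x0 x0] pmf_le_1[of "t x0" x0] by linarith
  have lim: "\<exists>l. \<forall>x\<in>S. (\<lambda>n. P n x y) \<longlonglongrightarrow> l" for y
  proof -
    \<comment> \<open>For a fixed target \<open>y\<close>, the extreme probabilities, over all
      starting points, of being at \<open>y\<close> after \<open>n\<close> steps. \<open>M\<close>
      never increases, \<open>m\<close> never decreases, and their gap shrinks
      geometrically.\<close>
    define M where "M n = Max ((\<lambda>x. P n x y) ` S)" for n
    define m where "m n = Min ((\<lambda>x. P n x y) ` S)" for n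
    have Mge: "P n x y \<le> M n" if "x \<in> S" for n x
      unfolding M_def using S that by (intro Max_ge) auto
    have mle: "m n \<le> P n x y" if "x \<in> S" for n x
      unfolding m_def using S that by (intro Min_le) auto
    have Mup: "P (Suc n) x y \<le> M n - \<delta> * (M n - m n)" if x: "x \<in> S" for n x
    proof -
      have "m n \<in> (\<lambda>x. P n x y) ` S" unfolding m_def using S by (intro Min_in) auto
      then obtain z0 where z0: "z0 \<in> S" "m n = P n z0 y" by blast
      \<comment> \<open>Subtracting \<open>M n\<close> makes every term nonpositive. The minimizing
        state \<open>z0\<close> has weight at least \<open>\<delta>\<close>, and its term alone
        yields the claimed decrease.\<close>
      have "P (Suc n) x y - M n = (\<Sum>z\<in>S. pmf (t x) z * (P n z y - M n))"
        using sum1[OF x] by (simp add: left[OF x] algebra_simps sum_subtractf sum_distrib_left[symmetric])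
      also have "\<dots> = pmf (t x) z0 * (P n z0 y - M n) + (\<Sum>z\<in>S - {z0}. pmf (t x) z * (P n z y - M n))"
        using S z0 by (simp add: sum.remove)
      also have "(\<Sum>z\<in>S - {z0}. pmf (t x) z * (P n z y - M n)) \<le> 0"
        using Mge by (intro sum_nonpos mult_nonneg_nonpos) auto
      also have "pmf (t x) z0 * (P n z0 y - M n) \<le> \<delta> * (P n z0 y - M n)"
        using \<delta>le[OF x z0(1)] Mge[OF z0(1), of n] by (intro mult_right_mono_neg) auto
      finally show ?thesis using z0 by (simp add: algebra_simps)
    qed
    have mlo: "m n \<le> P (Suc n) x y" if x: "x \<in> S" for n x
    proof -
      have "m n = (\<Sum>z\<in>S. pmf (t x) z * m n)"
        using sum1[OF x] by (simp add: sum_distrib_right[symmetric])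
      also have "\<dots> \<le> P (Suc n) x y"
        unfolding left[OF x] using mle by (intro sum_mono mult_left_mono) auto
      finally show ?thesis .
    qed
    have minc: "m n \<le> m (Suc n)" for n
      unfolding m_def[of "Suc n"] using S mlo by (subst Min_ge_iff) auto
    have Mcon: "M (Suc n) \<le> M n - \<delta> * (M n - m n)" for n
      unfolding M_def[of "Suc n"] using S Mup by (subst Max_le_iff) auto
    have mM: "m n \<le> M n" for n using mle[OF x0, of n] Mge[OF x0, of n] by linarith
    have osc: "M n - m n \<le> (1 - \<delta>) ^ n * (M 0 - m 0)" for n
    proof (induction n)
      case (Suc n)
      have "M (Suc n) - m (Suc n) \<le> (1 - \<delta>) * (M n - m n)"
        using minc[of n] Mcon[of n] by (simp add: algebra_simps)
      also have "\<dots> \<le> (1 - \<delta>) * ((1 - \<delta>) ^ n * (M 0 - m 0))"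
        using Suc \<delta>1 by (intro mult_left_mono) auto
      finally show ?case by simp
    qed simp
    have osc0: "(\<lambda>n. M n - m n) \<longlonglongrightarrow> 0"
    proof (rule tendsto_sandwich[where f = "\<lambda>_. 0"])
      show "(\<lambda>n. (1 - \<delta>) ^ n * (M 0 - m 0)) \<longlonglongrightarrow> 0"
        using \<delta>pos \<delta>1 by (intro tendsto_mult_left_zero LIMSEQ_realpow_zero) auto
    qed (use osc mM in auto)
    have "m n \<le> 1" for n using mle[OF x0, of n] pmf_le_1[of "kernel_power t n x0" y]
      by (simp add: P_def)
    then obtain l where l: "m \<longlonglongrightarrow> l"
      using minc incseq_convergent[of m 1] by (metis incseq_SucI)
    have Ml: "M \<longlonglongrightarrow> l" using tendsto_add[OF osc0 l] by simp
    have "(\<lambda>n. P n x y) \<longlonglongrightarrow> l" if "x \<in> S" for x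
      by (rule tendsto_sandwich[OF _ _ l Ml]) (use mle Mge that in auto)
    then show ?thesis by blast
  qed
  \<comment> \<open>The limit does not depend on the starting point. It remains to see that it is a
    probability vector on \<open>S\<close>, that it is invariant, and that no other law is.\<close>
  then obtain \<phi> where \<phi>: "\<And>x y. x \<in> S \<Longrightarrow> (\<lambda>n. P n x y) \<longlonglongrightarrow> \<phi> y" by metis
  have \<phi>0: "0 \<le> \<phi> y" for y
    by (rule LIMSEQ_le_const[OF \<phi>[OF x0]]) (simp add: P_def)
  have \<phi>out: "\<phi> y = 0" if "y \<notin> S" for y
  proof -
    have "P n x0 y = 0" for n
      unfolding P_def using supp[OF x0, of n] that by (auto simp: pmf_eq_0_set_pmf)
    then show ?thesis using \<phi>[OF x0, of y] by (simp add: LIMSEQ_const_iff)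
  qed
  have "(\<lambda>n. \<Sum>y\<in>S. P n x0 y) \<longlonglongrightarrow> (\<Sum>y\<in>S. \<phi> y)"
    by (intro tendsto_sum \<phi> x0)
  moreover have "(\<Sum>y\<in>S. P n x0 y) = 1" for n
    unfolding P_def by (rule sum_pmf_eq_1) (use S supp[OF x0] in auto)
  ultimately have \<phi>1: "(\<Sum>y\<in>S. \<phi> y) = 1" by (simp add: LIMSEQ_const_iff)
  define \<pi> where "\<pi> = embed_pmf \<phi>"
  have "(\<integral>\<^sup>+z. ennreal (\<phi> z) \<partial>count_space UNIV) = (\<Sum>z\<in>S. ennreal (\<phi> z))"
    by (rule nn_integral_count_space') (use \<phi>out S in auto)
  also have "\<dots> = ennreal (\<Sum>z\<in>S. \<phi> z)" by (rule sum_ennreal) (rule \<phi>0)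
  finally have \<pi>: "pmf \<pi> y = \<phi> y" for y
    unfolding \<pi>_def by (intro pmf_embed_pmf) (use \<phi>0 \<phi>1 in auto)
  have \<pi>S: "set_pmf \<pi> \<subseteq> S" using \<phi>out unfolding set_pmf_eq \<pi> by blast
  have \<pi>inv: "bind_pmf \<pi> t = \<pi>"
  proof (rule pmf_eqI)
    fix y
    have "(\<lambda>n. \<Sum>z\<in>S. P n x0 z * pmf (t z) y) \<longlonglongrightarrow> (\<Sum>z\<in>S. \<phi> z * pmf (t z) y)"
      by (intro tendsto_intros \<phi> x0)
    then have "(\<lambda>n. P (Suc n) x0 y) \<longlonglongrightarrow> (\<Sum>z\<in>S. \<phi> z * pmf (t z) y)"
      by (simp add: right[OF x0])
    moreover have "(\<lambda>n. P (Suc n) x0 y) \<longlonglongrightarrow> \<phi> y" using \<phi>[OF x0] by (rule LIMSEQ_Suc)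
    ultimately show "pmf (bind_pmf \<pi> t) y = pmf \<pi> y"
      unfolding pmf_bind_S[OF \<pi>S] \<pi> by (rule LIMSEQ_unique)
  qed
  have "q = \<pi>" if q: "set_pmf q \<subseteq> S" "bind_pmf q t = q" for q
  proof (rule pmf_eqI)
    fix y
    \<comment> \<open>Uniqueness: an invariant \<open>q\<close> is unchanged by \<open>n\<close>
      steps, so \<open>pmf q y\<close> is a \<open>q\<close>-average of numbers that all tend to
      \<open>\<phi> y\<close>.\<close>
    have const: "pmf q y = (\<Sum>x\<in>S. pmf q x * P n x y)" for n
      using pmf_bind_S[OF q(1), of "kernel_power t n" y] bind_kernel_power_invariant[OF q(2), of n]
      by (simp add: P_def)
    have "(\<lambda>n. \<Sum>x\<in>S. pmf q x * P n x y) \<longlonglongrightarrow> (\<Sum>x\<in>S. pmf q x * \<phi> y)"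
      by (intro tendsto_intros \<phi>)
    then have "pmf q y = (\<Sum>x\<in>S. pmf q x * \<phi> y)"
      by (simp add: const[symmetric] LIMSEQ_const_iff)
    also have "\<dots> = \<phi> y"
      using sum_pmf_eq_1[OF S(1) q(1)] by (simp add: sum_distrib_right[symmetric])
    finally show "pmf q y = pmf \<pi> y" by (simp add: \<pi>)
  qed
  then show ?thesis using \<pi>S \<pi>inv \<phi> unfolding P_def \<pi>[symmetric] by blast
qed

section \<open>Gibbs measures on the hypercube\<close>

definition sigmoid :: "real \<Rightarrow> real" where
  "sigmoid t = 1 / (1 + exp (- t))"

lemma sigmoid_pos: "0 < sigmoid t"
  by (simp add: sigmoid_def add_pos_pos)

lemma sigmoid_less_1: "sigmoid t < 1"
  by (simp add: sigmoid_def divide_simps add_pos_pos)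

lemma sigmoid_minus: "sigmoid (- t) = 1 - sigmoid t"
proof -
  have "1 + exp t \<noteq> 0" using exp_gt_zero[of t] by linarith
  then show ?thesis by (simp add: sigmoid_def exp_minus divide_simps add_pos_pos)
qed

lemma sigmoid_mono: "t \<le> u \<Longrightarrow> sigmoid t \<le> sigmoid u"
  by (simp add: sigmoid_def frac_le add_pos_pos)

lemma sigmoid_diff: "sigmoid (a - b) = exp a / (exp a + exp b)"
  by (simp add: sigmoid_def exp_diff exp_minus field_simps add_pos_pos)

text \<open>Lowering the argument by \<open>a - b\<close> costs at most the factor
  \<open>exp (b - a)\<close>, which is at least \<open>1 - (a - b)\<close>. The estimate is
  relative, so it stays useful when the values are tiny.\<close>

lemma sigmoid_ge_mult:
  assumes "b \<le> a"
  shows "sigmoid a * (1 - (a - b)) \<le> sigmoid b"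
proof -
  have "sigmoid a * (1 - (a - b)) \<le> sigmoid a * exp (b - a)"
    using exp_ge_add_one_self[of "b - a"] sigmoid_pos[of a] by (intro mult_left_mono) linarith+
  also have "\<dots> \<le> sigmoid b"
  proof -
    have "exp (b - a) * (1 + exp (- b)) = exp (b - a) + exp (- a)"
      by (simp add: distrib_left exp_add[symmetric])
    also have "\<dots> \<le> 1 + exp (- a)" using assms by simp
    finally show ?thesis
      by (simp add: sigmoid_def field_simps add_pos_pos)
  qed
  finally show ?thesis .
qed

text \<open>The Lipschitz constant is the size \<open>F\<close> of the values themselves. Dividing
  by \<open>F\<close>, as the weighted distance does, leaves just the difference of the
  arguments.\<close>

lemma abs_sigmoid_diff_le:
  assumes "sigmoid a \<le> F" "sigmoid b \<le> F"
  shows "\<bar>sigmoid a - sigmoid b\<bar> \<le> F * \<bar>a - b\<bar>"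
proof -
  have *: "\<bar>sigmoid a - sigmoid b\<bar> \<le> F * \<bar>a - b\<bar>" if "b \<le> a" "sigmoid a \<le> F" for a b
  proof -
    have "sigmoid a - sigmoid b \<le> sigmoid a * (a - b)"
      using sigmoid_ge_mult[OF that(1)] by (simp add: algebra_simps)
    also have "\<dots> \<le> F * (a - b)" using that by (intro mult_right_mono) auto
    finally show ?thesis using sigmoid_mono[OF that(1)] that by simp
  qed
  show ?thesis
    using *[of b a] *[of a b] assms by (cases "b \<le> a") (auto simp: abs_minus_commute)
qed

section \<open>Updates of a single coordinate under a Gibbs measure\<close>

lemma set_coord_nth [simp]: "set_coord j u x $ i = (if i = j then u else x $ i)"
  by (simp add: set_coord_def)

lemma set_coord_hypercube:
  "x \<in> hypercube \<Longrightarrow> u = 1 \<or> u = -1 \<Longrightarrow> set_coord j u x \<in> hypercube"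
  by (auto simp: hypercube_def)

lemma set_coord_set_coord [simp]: "set_coord j u (set_coord j v x) = set_coord j u x"
  by (simp add: vec_eq_iff)

lemma set_coord_same [simp]: "set_coord j (x $ j) x = x"
  by (simp add: vec_eq_iff)

lemma hypercube_cases: "x \<in> hypercube \<Longrightarrow> x $ i = 1 \<or> x $ i = -1"
  by (auto simp: hypercube_def)

text \<open>The conditional probability, under \<open>gibbs_pmf h\<close>, that coordinate
  \<open>j\<close> equals 1 given the other coordinates of \<open>x\<close>. The normalizing
  constant cancels, so only a difference of two values of \<open>h\<close> enters.\<close>

definition cond_prob :: "(real ^ 'd \<Rightarrow> real) \<Rightarrow> 'd \<Rightarrow> real ^ 'd \<Rightarrow> real" where
  "cond_prob h j x = sigmoid (h (set_coord j 1 x) - h (set_coord j (-1) x))"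

definition resample :: "(real ^ 'd \<Rightarrow> real) \<Rightarrow> 'd \<Rightarrow> real ^ 'd \<Rightarrow> (real ^ 'd) pmf" where
  "resample h j x =
    map_pmf (\<lambda>b. set_coord j (if b then 1 else -1) x) (bernoulli_pmf (cond_prob h j x))"

lemma cond_prob_bounds: "0 \<le> cond_prob h j x" "cond_prob h j x \<le> 1"
  using sigmoid_pos sigmoid_less_1 by (auto simp: cond_prob_def intro: less_imp_le)

lemma pmf_resample:
  "pmf (resample h j x) y = cond_prob h j x * of_bool (set_coord j 1 x = y) +
    (1 - cond_prob h j x) * of_bool (set_coord j (-1) x = y)"
  unfolding resample_def map_pmf_def pmf_bind
  using cond_prob_bounds[of h j x] by (simp add: indicator_def mult.commute)

lemma set_pmf_resample: "z \<in> set_pmf (resample h j x) \<Longrightarrow> i \<noteq> j \<Longrightarrow> z $ i = x $ i"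
  by (auto simp: resample_def)

text \<open>An update of coordinate \<open>j\<close> only redistributes mass inside the pair of
  states that agree off \<open>j\<close>, and it does so in proportion to their Gibbs
  weights.\<close>

lemma bind_gibbs_resample: "bind_pmf (gibbs_pmf h) (resample h j) = gibbs_pmf h"
proof (rule pmf_eqI)
  fix y
  let ?Z = "\<Sum>w\<in>hypercube. exp (h w)"
  have Z: "?Z > 0" by (intro sum_pos) (auto simp: finite_hypercube hypercube_not_empty)
  have eq: "pmf (bind_pmf (gibbs_pmf h) (resample h j)) y =
      (\<Sum>x\<in>hypercube. pmf (gibbs_pmf h) x * pmf (resample h j x) y)"
    by (rule pmf_bind_finite) (auto simp: finite_hypercube set_pmf_gibbs_pmf)
  show "pmf (bind_pmf (gibbs_pmf h) (resample h j)) y = pmf (gibbs_pmf h) y"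
  proof (cases "y \<in> hypercube")
    case False
    then have "pmf (resample h j x) y = 0" if "x \<in> hypercube" for x
      using set_coord_hypercube[OF that] by (auto simp: pmf_resample)
    then show ?thesis using False by (simp add: eq pmf_gibbs_pmf)
  next
    case True
    let ?a = "set_coord j 1 y" and ?b = "set_coord j (-1) y"
    have ab: "?a \<in> hypercube" "?b \<in> hypercube" using True by (auto intro: set_coord_hypercube)
    have neq: "?a \<noteq> ?b" by (auto simp: vec_eq_iff)
    have y: "y = ?a \<or> y = ?b"
      using hypercube_cases[OF True, of j] by (auto simp: vec_eq_iff)
    have out: "pmf (resample h j x) y = 0" if "x \<in> hypercube - {?a, ?b}" for x
    proof -
      \<comment> \<open>A state that the update sends to \<open>y\<close> agrees with
        \<open>y\<close> off coordinate \<open>j\<close>, so it is one of the two members of the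
        pair.\<close>
      have "x = set_coord j (x $ j) y" if "set_coord j u x = y" for u
        unfolding that[symmetric] by simp
      then have "set_coord j u x \<noteq> y" for u
        using that hypercube_cases[of x j] by auto
      then show ?thesis by (simp add: pmf_resample)
    qed
    have "(\<Sum>x\<in>hypercube. pmf (gibbs_pmf h) x * pmf (resample h j x) y) =
        (\<Sum>x\<in>{?a, ?b}. pmf (gibbs_pmf h) x * pmf (resample h j x) y)"
      by (rule sum.mono_neutral_right) (use ab out in \<open>auto simp: finite_hypercube\<close>)
    also have "\<dots> = exp (h y) / ?Z"
    proof -
      have E: "exp (h ?a) + exp (h ?b) > 0" by (simp add: add_pos_pos)
      have c1: "1 - exp (h ?a) / (exp (h ?a) + exp (h ?b)) = exp (h ?b) / (exp (h ?a) + exp (h ?b))"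
        using E by (simp add: field_simps)
      have c2: "exp (h ?a) / ?Z * (t / (exp (h ?a) + exp (h ?b))) +
        exp (h ?b) / ?Z * (t / (exp (h ?a) + exp (h ?b))) = t / ?Z" for t
      proof -
        have "exp (h ?a) / ?Z * (t / (exp (h ?a) + exp (h ?b))) +
          exp (h ?b) / ?Z * (t / (exp (h ?a) + exp (h ?b))) =
          (exp (h ?a) + exp (h ?b)) * t / (?Z * (exp (h ?a) + exp (h ?b)))"
          by (simp add: add_divide_distrib distrib_right)
        then show ?thesis using E Z by simp
      qed
      show ?thesis
        using y neq ab c2[of "exp (h y)"]
        by (auto simp: pmf_gibbs_pmf pmf_resample cond_prob_def sigmoid_diff c1 mult.commute)
    qed
    finally show ?thesis using True by (simp add: eq pmf_gibbs_pmf)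
  qed
qed

lemma resample_coupling:
  "\<exists>c\<in>couplings (resample h j x) (resample g j y).
    measure_pmf.expectation c (\<lambda>(x, y). of_bool (x $ j \<noteq> y $ j)) =
      \<bar>cond_prob h j x - cond_prob g j y\<bar>"
proof -
  obtain c where c: "c \<in> couplings (bernoulli_pmf (cond_prob h j x)) (bernoulli_pmf (cond_prob g j y))"
    "measure_pmf.expectation c (\<lambda>(x, y). of_bool (x \<noteq> y)) = \<bar>cond_prob h j x - cond_prob g j y\<bar>"
    using bernoulli_coupling cond_prob_bounds by metis
  let ?f = "\<lambda>z b. set_coord j (if b then 1 else -1 :: real) z"
  let ?c = "map_pmf (\<lambda>(a, b). (?f x a, ?f y b)) c"
  have "map_pmf fst ?c = map_pmf (?f x) (map_pmf fst c)"
    "map_pmf snd ?c = map_pmf (?f y) (map_pmf snd c)"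
    by (simp_all add: map_pmf_comp case_prod_unfold)
  then have "?c \<in> couplings (resample h j x) (resample g j y)"
    using c(1) by (simp add: couplings_def resample_def)
  moreover have "measure_pmf.expectation ?c (\<lambda>(x, y). of_bool (x $ j \<noteq> y $ j)) =
      measure_pmf.expectation c (\<lambda>(x, y). of_bool (x \<noteq> y) :: real)"
    unfolding integral_map_pmf by (intro expectation_cong_pmf) (auto split: prod.splits)
  ultimately show ?thesis using c(2) by metis
qed

text \<open>Both Gibbs measures are invariant under resampling one coordinate, so resampling the
  coordinates in turn, each time with an optimal coupling of the two conditional laws, keeps the
  marginals.\<close>

lemma gibbs_sweep_coupling:
  fixes h g :: "real ^ 'd \<Rightarrow> real" and B :: "'d \<Rightarrow> real ^ 'd \<Rightarrow> real"
  assumes B: "\<And>j x y. x \<in> hypercube \<Longrightarrow> y \<in> hypercube \<Longrightarrow>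
    \<bar>cond_prob h j x - cond_prob g j y\<bar> \<le> B j y"
  shows "\<exists>c\<in>couplings (gibbs_pmf h) (gibbs_pmf g). \<forall>j.
    measure_pmf.expectation c (\<lambda>(x, y). of_bool (x $ j \<noteq> y $ j)) \<le>
      measure_pmf.expectation (gibbs_pmf g) (B j)"
proof -
  let ?D = "\<lambda>j (x, y). of_bool (x $ j \<noteq> y $ j) :: real"
  have fin: "finite (set_pmf (gibbs_pmf f))" for f :: "real ^ 'd \<Rightarrow> real"
    by (simp add: set_pmf_gibbs_pmf finite_hypercube)
  have "\<exists>c\<in>couplings (gibbs_pmf h) (gibbs_pmf g). \<forall>j\<in>J.
    measure_pmf.expectation c (?D j) \<le> measure_pmf.expectation (gibbs_pmf g) (B j)"
    if "finite J" for J
    using that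
  proof (induction J)
    case empty
    then show ?case using pair_pmf_couplings by blast
  next
    case (insert j J)
    then obtain c where c: "c \<in> couplings (gibbs_pmf h) (gibbs_pmf g)"
      "\<And>i. i \<in> J \<Longrightarrow> measure_pmf.expectation c (?D i) \<le> measure_pmf.expectation (gibbs_pmf g) (B i)"
      by blast
    have "\<forall>z. \<exists>k. k \<in> couplings (resample h j (fst z)) (resample g j (snd z)) \<and>
      measure_pmf.expectation k (?D j) = \<bar>cond_prob h j (fst z) - cond_prob g j (snd z)\<bar>"
      using resample_coupling by blast
    then obtain k where k: "\<And>z. k z \<in> couplings (resample h j (fst z)) (resample g j (snd z))"
      "\<And>z. measure_pmf.expectation (k z) (?D j) = \<bar>cond_prob h j (fst z) - cond_prob g j (snd z)\<bar>"
      by metis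
    have finc: "finite (set_pmf c)" by (rule finite_set_pmf_coupling[OF c(1) fin fin])
    have fink: "finite (set_pmf (k z))" for z
      by (rule finite_set_pmf_coupling[OF k(1)]) (simp_all add: resample_def)
    have cH: "fst z \<in> hypercube" "snd z \<in> hypercube" if "z \<in> set_pmf c" for z
      using set_pmf_coupling[OF c(1)] that by (auto simp: set_pmf_gibbs_pmf)
    have "bind_pmf c k \<in> couplings (bind_pmf (gibbs_pmf h) (resample h j))
        (bind_pmf (gibbs_pmf g) (resample g j))"
      by (rule bind_pmf_couplings[OF c(1)]) (use k(1) in force)
    then have mem: "bind_pmf c k \<in> couplings (gibbs_pmf h) (gibbs_pmf g)"
      by (simp add: bind_gibbs_resample)
    have E: "measure_pmf.expectation (bind_pmf c k) (?D i) =
        measure_pmf.expectation c (\<lambda>z. measure_pmf.expectation (k z) (?D i))" for i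
      by (rule expectation_bind_finite[OF finc fink])
    have "measure_pmf.expectation (bind_pmf c k) (?D i) \<le> measure_pmf.expectation (gibbs_pmf g) (B i)"
      if i: "i \<in> insert j J" for i
    proof (cases "i = j")
      case True
      \<comment> \<open>The bound \<open>B j\<close> looks only at the second state, whose law is
        \<open>gibbs_pmf g\<close> under every coupling. Its expectation therefore does not depend
        on the stage of the sweep.\<close>
      have "measure_pmf.expectation (bind_pmf c k) (?D j) \<le>
          measure_pmf.expectation c (\<lambda>z. B j (snd z))"
        unfolding E k(2) using B cH by (intro expectation_mono_finite finc) auto
      then show ?thesis using expectation_coupling_snd[OF c(1), of "B j"] True by simp
    next
      case False
      \<comment> \<open>Updating coordinate \<open>j\<close> leaves the other coordinates alone, so
        the bounds obtained earlier in the sweep survive.\<close>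
      have "measure_pmf.expectation (k z) (?D i) = ?D i z" for z
      proof -
        have "?D i w = ?D i z" if "w \<in> set_pmf (k z)" for w
        proof -
          have "fst w \<in> set_pmf (resample h j (fst z))" "snd w \<in> set_pmf (resample g j (snd z))"
            using set_pmf_coupling[OF k(1)[of z]] that by (auto simp del: split_paired_All)
          then show ?thesis using False by (simp add: set_pmf_resample case_prod_unfold)
        qed
        then have "measure_pmf.expectation (k z) (?D i) = measure_pmf.expectation (k z) (\<lambda>_. ?D i z)"
          by (rule expectation_cong_pmf)
        then show ?thesis by simp
      qed
      then show ?thesis using c(2)[of i] i False unfolding E by simp
    qed
    then show ?case using mem by blast
  qed
  from this[OF finite_class.finite_UNIV] show ?thesis by simp
qed

section \<open>The proximal kernels\<close>

lemma inner_set_coord: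
  fixes z :: "real ^ 'd"
  shows "z \<bullet> set_coord j u x = z $ j * u + (\<Sum>k\<in>UNIV - {j}. z $ k * x $ k)"
  by (simp add: inner_vec_def sum.remove[of UNIV j])

section \<open>Sign flips of the hypercube and the forward move\<close>

definition vmul :: "real ^ 'd \<Rightarrow> real ^ 'd \<Rightarrow> real ^ 'd" where
  "vmul x y = (\<chi> i. x $ i * y $ i)"

lemma vmul_nth [simp]: "vmul x y $ i = x $ i * y $ i"
  by (simp add: vmul_def)

lemma vmul_vmul: "x \<in> hypercube \<Longrightarrow> vmul x (vmul x y) = y"
  unfolding vec_eq_iff using hypercube_cases[of x] by (metis minus_mult_minus mult_1 mult_minus1 vmul_nth)

lemma vmul_hypercube: "x \<in> hypercube \<Longrightarrow> y \<in> hypercube \<Longrightarrow> vmul x y \<in> hypercube"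
  unfolding hypercube_def mem_Collect_eq vmul_nth by (metis minus_mult_minus mult_1 mult_minus1)

lemma sum_hypercube_vmul:
  "x \<in> hypercube \<Longrightarrow> (\<Sum>w\<in>hypercube. f (vmul x w)) = (\<Sum>w\<in>hypercube. f w)"
  by (rule sum.reindex_bij_witness[of _ "vmul x" "vmul x"]) (auto simp: vmul_vmul vmul_hypercube)

text \<open>Multiplication by the sign vector \<open>x\<close> permutes the hypercube and turns the
  inner product with \<open>x\<close> into the one with the all-ones vector.\<close>

lemma dups_u_normalizer:
  fixes x :: "real ^ 'd"
  assumes "x \<in> hypercube"
  shows "(\<Sum>w\<in>hypercube. exp ((x \<bullet> w) / \<eta>)) = (\<Sum>w\<in>hypercube. exp (((\<chi> i. 1) \<bullet> (w :: real ^ 'd)) / \<eta>))"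
  using sum_hypercube_vmul[OF assms, of "\<lambda>w. exp (((\<chi> i. 1) \<bullet> w) / \<eta>)"]
  by (simp add: inner_vec_def)

text \<open>The forward move multiplies \<open>x\<close> by random signs whose law is the same for
  all \<open>x\<close>. Two chains can therefore share these signs.\<close>

lemma dups_u_vmul:
  fixes x :: "real ^ 'd"
  assumes x: "x \<in> hypercube"
  shows "dups_u \<eta> x = map_pmf (vmul x) (dups_u \<eta> (\<chi> i. 1))"
proof (rule pmf_eqI)
  fix y
  have "inj (vmul x)" by (metis injI vmul_vmul[OF x])
  then have "pmf (map_pmf (vmul x) (dups_u \<eta> (\<chi> i. 1))) y = pmf (dups_u \<eta> (\<chi> i. 1)) (vmul x y)"
    using pmf_map_inj'[of "vmul x" _ "vmul x y"] by (simp add: vmul_vmul[OF x])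
  moreover have "vmul x y \<in> hypercube \<longleftrightarrow> y \<in> hypercube"
    using vmul_vmul[OF x, of y] vmul_hypercube[OF x] by metis
  moreover have "(\<chi> i. 1) \<bullet> vmul x y = x \<bullet> y" by (simp add: inner_vec_def)
  ultimately show "pmf (dups_u \<eta> x) y = pmf (map_pmf (vmul x) (dups_u \<eta> (\<chi> i. 1))) y"
    by (simp add: dups_u_def pmf_gibbs_pmf dups_u_normalizer[OF x])
qed

text \<open>The exact backward kernel, which the DUPS kernel \<^const>\<open>dups_v\<close> approximates by replacing
  \<open>ln p\<close> with its linearization at \<open>z\<close>.\<close>

definition prox :: "real \<Rightarrow> (real ^ 'd) pmf \<Rightarrow> real ^ 'd \<Rightarrow> (real ^ 'd) pmf" where
  "prox \<eta> p z = gibbs_pmf (\<lambda>x. ln (pmf p x) + (z \<bullet> x) / \<eta>)"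

text \<open>This is the two-block Gibbs sampler for the joint law of \<open>x\<close> and
  \<open>z\<close>. As the normalizer of \<open>dups_u\<close> does not depend on \<open>x\<close>,
  Bayes' formula makes \<open>prox\<close> the conditional law of \<open>x\<close> given
  \<open>z\<close>.\<close>

lemma bind_prox_invariant:
  fixes p :: "(real ^ 'd) pmf"
  assumes p: "set_pmf p = hypercube"
  shows "bind_pmf p (\<lambda>x. bind_pmf (dups_u \<eta> x) (prox \<eta> p)) = p"
proof (rule pmf_eqI)
  fix y
  let ?H = "hypercube :: (real ^ 'd) set"
  define Z where "Z = (\<Sum>w\<in>?H. exp (((\<chi> i. 1) \<bullet> w) / \<eta>))"
  define R where "R z = (\<Sum>w\<in>?H. pmf p w * exp ((z \<bullet> w) / \<eta>))" for z
  have Z: "Z > 0"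
    unfolding Z_def by (intro sum_pos) (auto simp: finite_hypercube hypercube_not_empty)
  have ppos: "pmf p w > 0" if "w \<in> ?H" for w
    using that p by (auto simp: pmf_positive_iff)
  have R: "R z > 0" for z
    unfolding R_def by (intro sum_pos) (auto simp: finite_hypercube hypercube_not_empty ppos)
  have u: "pmf (dups_u \<eta> x) z = (if z \<in> ?H then exp ((x \<bullet> z) / \<eta>) / Z else 0)"
    if "x \<in> ?H" for x z
    by (simp add: dups_u_def pmf_gibbs_pmf dups_u_normalizer[OF that] Z_def)
  have v: "pmf (prox \<eta> p z) x = (if x \<in> ?H then pmf p x * exp ((z \<bullet> x) / \<eta>) / R z else 0)" for x z
  proof -
    have "(\<Sum>w\<in>?H. exp (ln (pmf p w) + (z \<bullet> w) / \<eta>)) = R z"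
      unfolding R_def using ppos by (intro sum.cong refl) (simp add: exp_add)
    then show ?thesis using ppos by (simp add: prox_def pmf_gibbs_pmf exp_add)
  qed
  \<comment> \<open>The law of the forward variable is, up to the constant \<open>Z\<close>, the
    normalizer of the backward kernel, so the two cancel below.\<close>
  have pu: "pmf (bind_pmf p (dups_u \<eta>)) z = R z / Z" if "z \<in> ?H" for z
  proof -
    have "pmf (bind_pmf p (dups_u \<eta>)) z = (\<Sum>x\<in>?H. pmf p x * pmf (dups_u \<eta> x) z)"
      by (rule pmf_bind_finite) (simp_all add: finite_hypercube p)
    also have "\<dots> = (\<Sum>x\<in>?H. pmf p x * exp ((z \<bullet> x) / \<eta>) / Z)"
      using that by (intro sum.cong refl) (simp add: u inner_commute)
    finally show ?thesis by (simp add: R_def sum_divide_distrib)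
  qed
  have "bind_pmf p (\<lambda>x. bind_pmf (dups_u \<eta> x) (prox \<eta> p)) = bind_pmf (bind_pmf p (dups_u \<eta>)) (prox \<eta> p)"
    by (simp add: bind_assoc_pmf)
  also have "pmf \<dots> y = (\<Sum>z\<in>?H. pmf (bind_pmf p (dups_u \<eta>)) z * pmf (prox \<eta> p z) y)"
    by (rule pmf_bind_finite) (auto simp: finite_hypercube dups_u_def set_pmf_gibbs_pmf)
  also have "\<dots> = (\<Sum>z\<in>?H. pmf p y * pmf (dups_u \<eta> y) z)"
  proof (intro sum.cong refl)
    fix z assume z: "z \<in> ?H"
    have "pmf p y = 0" if "y \<notin> ?H" using that p by (simp add: pmf_eq_0_set_pmf)
    then show "pmf (bind_pmf p (dups_u \<eta>)) z * pmf (prox \<eta> p z) y = pmf p y * pmf (dups_u \<eta> y) z"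
      using R[of z] z by (auto simp: pu u v inner_commute)
  qed
  also have "\<dots> = pmf p y"
    using sum_pmf_eq_1[of ?H "dups_u \<eta> y"]
    by (simp add: sum_distrib_left[symmetric] finite_hypercube dups_u_def set_pmf_gibbs_pmf)
  finally show "pmf (bind_pmf p (\<lambda>x. bind_pmf (dups_u \<eta> x) (prox \<eta> p))) y = pmf p y" .
qed

lemma hamming_nonneg: "0 \<le> hamming x y"
  by (simp add: hamming_def sum_nonneg)

lemma l1_norm_diff_hypercube:
  assumes "x \<in> hypercube" "y \<in> hypercube"
  shows "l1_norm (x - y) = 2 * hamming x y"
  unfolding l1_norm_def hamming_def sum_distrib_left
proof (intro sum.cong refl)
  fix i
  show "\<bar>(x - y) $ i\<bar> = 2 * of_bool (x $ i \<noteq> y $ i)"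
    using hypercube_cases[OF assms(1), of i] hypercube_cases[OF assms(2), of i] by auto
qed

section \<open>Contraction of a weighted Hamming distance\<close>

locale proximal_sampler =
  fixes p :: "(real ^ 'd) pmf" and s :: "real ^ 'd \<Rightarrow> real ^ 'd" and \<eta> d :: real
  assumes p_pos: "set_pmf p = hypercube"
    and score: "s = glauber_score p"
    and eta_pos: "\<eta> > 0"
    and step_size: "\<And>x i. x \<in> hypercube \<Longrightarrow> x $ i * s x $ i \<ge> - 1 / (2 * \<eta>)"
    and d_def: "d = real CARD('d)"
    and smooth: "8 * d * score_beta2 s \<le> 1"
begin

section \<open>Flip probabilities and the distance weighted by them\<close>

lemma d_ge_1: "1 \<le> d"
  using zero_less_card_finite[where 'a = 'd] unfolding d_def by linarith

text \<open>The probability that \<open>dups_v\<close> started at \<open>z\<close> reverses the sign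
  of coordinate \<open>j\<close>, for either value of that sign.\<close>

definition flip :: "'d \<Rightarrow> real ^ 'd \<Rightarrow> real" where
  "flip j z = sigmoid (- 2 * (1 / \<eta> + z $ j * s z $ j))"

definition max_flip :: "'d \<Rightarrow> real" where
  "max_flip j = Max (flip j ` hypercube)"

definition wdist :: "real ^ 'd \<Rightarrow> real ^ 'd \<Rightarrow> real" where
  "wdist x y = (\<Sum>j\<in>UNIV. of_bool (x $ j \<noteq> y $ j) / max_flip j)"

definition flip_bound :: real where
  "flip_bound = sigmoid (- 1 / \<eta>)"

lemma flip_le_max: "z \<in> hypercube \<Longrightarrow> flip j z \<le> max_flip j"
  unfolding max_flip_def by (intro Max_ge) (auto simp: finite_hypercube)

lemma max_flip_attained: "\<exists>z\<in>hypercube. max_flip j = flip j z"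
proof -
  have "max_flip j \<in> flip j ` hypercube"
    unfolding max_flip_def by (intro Max_in) (auto simp: finite_hypercube hypercube_not_empty)
  then show ?thesis by blast
qed

lemma max_flip_pos: "0 < max_flip j"
  using max_flip_attained[of j] sigmoid_pos by (auto simp: flip_def)

text \<open>The step-size condition gives \<open>1 / \<eta> + z $ j * s z $ j\<close> at least
  \<open>1 / (2 * \<eta>)\<close>; the factor 2 in \<open>flip\<close> then produces the argument
  \<open>- 1 / \<eta>\<close>.\<close>

lemma flip_le_bound: "z \<in> hypercube \<Longrightarrow> flip j z \<le> flip_bound"
  unfolding flip_def flip_bound_def
  using step_size[of z j] by (intro sigmoid_mono) (simp add: field_simps)

lemma flip_bound_nonneg: "0 \<le> flip_bound"
  by (simp add: flip_bound_def sigmoid_pos less_imp_le)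

lemma flip_bound_le_half: "flip_bound \<le> 1 / 2"
proof -
  have "flip_bound \<le> sigmoid 0"
    unfolding flip_bound_def using eta_pos by (intro sigmoid_mono) simp
  then show ?thesis by (simp add: sigmoid_def)
qed

lemma flip_bound_le_exp: "flip_bound \<le> exp (- 1 / \<eta>)"
proof -
  have "1 / (1 + exp (1 / \<eta>)) \<le> 1 / exp (1 / \<eta>)" by (intro divide_left_mono) (auto simp: add_pos_pos)
  then show ?thesis by (simp add: flip_bound_def sigmoid_def exp_minus divide_inverse)
qed

section \<open>Sensitivity of the score and of the flip probabilities to the state\<close>

lemma score_set_coord: "s (set_coord j u x) $ j = s x $ j"
  by (simp add: score glauber_score_def)

lemma score_diff_le_hamming:
  assumes "x \<in> hypercube" "y \<in> hypercube"
  shows "\<bar>s x $ j - s y $ j\<bar> \<le> hamming x y / (4 * d)"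
proof (cases "x = y")
  case True
  then show ?thesis using d_ge_1 by (simp add: hamming_nonneg)
next
  case False
  let ?A = "{infnorm (s x - s y) / l1_norm (x - y) |x y. x \<in> hypercube \<and> y \<in> hypercube \<and> x \<noteq> y}"
  \<comment> \<open>Finiteness makes the \<open>Max\<close> in \<open>score_beta2\<close> a genuine
    upper bound for the ratios.\<close>
  have "?A \<subseteq> (\<lambda>(x, y). infnorm (s x - s y) / l1_norm (x - y)) ` (hypercube \<times> hypercube)"
    by auto
  then have "finite ?A" by (meson finite_imageI finite_SigmaI finite_hypercube finite_subset)
  then have "infnorm (s x - s y) / l1_norm (x - y) \<le> score_beta2 s"
    unfolding score_beta2_def using assms False by (intro Max_ge) auto
  also have "\<dots> \<le> 1 / (8 * d)" using smooth d_ge_1 by (simp add: field_simps)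
  finally have le: "infnorm (s x - s y) / l1_norm (x - y) \<le> 1 / (8 * d)" .
  obtain i where "x $ i \<noteq> y $ i" using False by (auto simp: vec_eq_iff)
  then have "0 < hamming x y"
    unfolding hamming_def by (intro sum_pos2[of _ i]) auto
  \<comment> \<open>On the hypercube the l1 distance is twice the Hamming distance, which turns
    \<open>1 / (8 * d)\<close> into \<open>1 / (4 * d)\<close>.\<close>
  then have "infnorm (s x - s y) \<le> hamming x y / (4 * d)"
    using le d_ge_1 by (simp add: l1_norm_diff_hypercube[OF assms] field_simps)
  moreover have "\<bar>(s x - s y) $ j\<bar> \<le> infnorm (s x - s y)" by (rule component_le_infnorm_cart)
  ultimately show ?thesis by simp
qed

text \<open>Component \<open>j\<close> of the score ignores coordinate \<open>j\<close>, so both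
  points may first be given the value 1 there. At most \<open>d - 1\<close> disagreements then
  count, and this saving is what makes the contraction strict.\<close>

lemma score_diff_le:
  assumes "x \<in> hypercube" "y \<in> hypercube"
  shows "\<bar>s x $ j - s y $ j\<bar> \<le> (\<Sum>k\<in>UNIV - {j}. of_bool (x $ k \<noteq> y $ k)) / (4 * d)"
proof -
  have "hamming (set_coord j 1 x) (set_coord j 1 y) = (\<Sum>k\<in>UNIV - {j}. of_bool (x $ k \<noteq> y $ k))"
    unfolding hamming_def
    by (subst sum.remove[of UNIV j]) (auto simp del: sum_of_bool_eq intro!: sum.cong)
  then show ?thesis
    using score_diff_le_hamming[OF set_coord_hypercube[OF assms(1)] set_coord_hypercube[OF assms(2)], of 1 1 j j j]
    by (simp add: score_set_coord)
qed

text \<open>The scores differ by at most \<open>(d - 1) / (4 * d)\<close>, the arguments of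
  \<open>sigmoid\<close> by twice that, and \<open>sigmoid_ge_mult\<close> loses the factor
  \<open>1 - (d - 1) / (2 * d)\<close>, which is \<open>(d + 1) / (2 * d)\<close>.\<close>

lemma flip_ge_mult_flip:
  assumes "x \<in> hypercube" "y \<in> hypercube" "x $ j = y $ j"
  shows "flip j x * ((d + 1) / (2 * d)) \<le> flip j y"
proof -
  define A where "A = - 2 * (1 / \<eta> + x $ j * s x $ j)"
  define B where "B = - 2 * (1 / \<eta> + y $ j * s y $ j)"
  have "(\<Sum>k\<in>UNIV - {j}. of_bool (x $ k \<noteq> y $ k) :: real) \<le> (\<Sum>k\<in>UNIV - {j}. 1)"
    by (intro sum_mono) auto
  also have "\<dots> = d - 1" using d_ge_1 by (simp add: card_Diff_singleton d_def)
  finally have "(\<Sum>k\<in>UNIV - {j}. of_bool (x $ k \<noteq> y $ k)) / (4 * d) \<le> (d - 1) / (4 * d)"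
    using d_ge_1 by (intro divide_right_mono) auto
  then have sd: "\<bar>s x $ j - s y $ j\<bar> \<le> (d - 1) / (4 * d)"
    using score_diff_le[OF assms(1,2), of j] by linarith
  have AB: "\<bar>A - B\<bar> = 2 * \<bar>s x $ j - s y $ j\<bar>"
    using hypercube_cases[OF assms(1), of j] assms(3) by (auto simp: A_def B_def abs_if)
  have eq: "(d + 1) / (2 * d) = 1 - 2 * ((d - 1) / (4 * d))" using d_ge_1 by (simp add: field_simps)
  show ?thesis
  proof (cases "B \<le> A")
    case True
    have "A - B = 2 * \<bar>s x $ j - s y $ j\<bar>" using AB True by simp
    also have "\<dots> \<le> 2 * ((d - 1) / (4 * d))" using sd by (rule mult_left_mono) simp
    finally have "sigmoid A * ((d + 1) / (2 * d)) \<le> sigmoid A * (1 - (A - B))"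
      unfolding eq using sigmoid_pos[of A] by (intro mult_left_mono) auto
    then show ?thesis using sigmoid_ge_mult[OF True] by (simp add: flip_def A_def B_def)
  next
    case False
    have "sigmoid A * ((d + 1) / (2 * d)) \<le> sigmoid A * 1"
      using d_ge_1 sigmoid_pos[of A] by (intro mult_left_mono) auto
    then show ?thesis using sigmoid_mono[of A B] False by (simp add: flip_def A_def B_def)
  qed
qed

section \<open>Comparison of the two backward kernels, one coordinate at a time\<close>

lemma cond_prob_dups_v:
  "cond_prob (\<lambda>x. (z /\<^sub>R \<eta> + s z) \<bullet> x) j x = sigmoid (2 * (z $ j / \<eta> + s z $ j))"
  unfolding cond_prob_def inner_set_coord by (simp add: divide_inverse mult.commute)

text \<open>The log ratio of \<open>p\<close> at the two values of coordinate \<open>j\<close> is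
  exactly twice the score. The exact kernel thus differs from \<open>dups_v\<close> only in
  evaluating the score at the current state \<open>y\<close> instead of the forward variable
  \<open>z\<close>.\<close>

lemma cond_prob_prox:
  "cond_prob (\<lambda>x. ln (pmf p x) + (z \<bullet> x) / \<eta>) j y = sigmoid (2 * (z $ j / \<eta> + s y $ j))"
  unfolding cond_prob_def inner_set_coord
  by (simp add: score glauber_score_def add_divide_distrib diff_divide_distrib algebra_simps)

lemma sigmoid_flip:
  assumes "y \<in> hypercube" "b = 1 \<or> b = -1"
  shows "sigmoid (2 * (b / \<eta> + s y $ j)) =
    (if b = 1 then 1 - flip j (set_coord j b y) else flip j (set_coord j b y))"
  using assms(2) sigmoid_minus[of "2 * (1 / \<eta> + s y $ j)"]
  by (auto simp: flip_def score_set_coord)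

text \<open>If the forward variables agree at \<open>j\<close>, two flip probabilities are compared
  through the Lipschitz bound. If they disagree, the laws favour opposite signs, and the flips bring
  the two updates together often enough to gain the fixed amount
  \<open>(d + 1) / (2 * d)\<close>.\<close>

lemma cond_prob_diff_le:
  assumes z: "z \<in> hypercube" and z': "z' \<in> hypercube" and y: "y \<in> hypercube"
  shows "\<bar>sigmoid (2 * (z $ j / \<eta> + s z $ j)) - sigmoid (2 * (z' $ j / \<eta> + s y $ j))\<bar> / max_flip j \<le>
    (if z $ j = z' $ j
     then (hamming z z' + (\<Sum>k\<in>UNIV - {j}. of_bool (y $ k \<noteq> z' $ k))) / (2 * d)
     else 1 / max_flip j - (d + 1) / (2 * d))"
proof -
  \<comment> \<open>Since the score at \<open>j\<close> ignores coordinate \<open>j\<close>, the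
    exact update of \<open>y\<close> with forward variable \<open>z'\<close> flips with probability
    \<open>flip j y'\<close>.\<close>
  define y' where "y' = set_coord j (z' $ j) y"
  have y': "y' \<in> hypercube"
    unfolding y'_def using y hypercube_cases[OF z', of j] by (intro set_coord_hypercube) auto
  have g: "sigmoid (2 * (z $ j / \<eta> + s z $ j)) = (if z $ j = 1 then 1 - flip j z else flip j z)"
    using sigmoid_flip[OF z hypercube_cases[OF z], of j j] unfolding set_coord_same .
  have g': "sigmoid (2 * (z' $ j / \<eta> + s y $ j)) = (if z' $ j = 1 then 1 - flip j y' else flip j y')"
    using sigmoid_flip[OF y hypercube_cases[OF z'], of j j] by (simp add: y'_def)
  have F: "max_flip j > 0" by (rule max_flip_pos)
  show ?thesis
  proof (cases "z $ j = z' $ j")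
    case True
    let ?S = "\<lambda>x y. \<Sum>k\<in>UNIV - {j}. of_bool (x $ k \<noteq> y $ k) :: real"
    have "\<bar>flip j z - flip j y'\<bar> \<le> max_flip j *
        \<bar>- 2 * (1 / \<eta> + z $ j * s z $ j) - - 2 * (1 / \<eta> + y' $ j * s y' $ j)\<bar>"
      using flip_le_max[OF z] flip_le_max[OF y'] unfolding flip_def by (rule abs_sigmoid_diff_le)
    also have "\<bar>- 2 * (1 / \<eta> + z $ j * s z $ j) - - 2 * (1 / \<eta> + y' $ j * s y' $ j)\<bar> =
        2 * \<bar>s z $ j - s y $ j\<bar>"
      using hypercube_cases[OF z, of j] True by (auto simp: y'_def score_set_coord abs_if)
    also have "max_flip j * (2 * \<bar>s z $ j - s y $ j\<bar>) \<le> max_flip j * (?S z y / (2 * d))"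
      using score_diff_le[OF z y, of j] F by (intro mult_left_mono) (auto simp: field_simps)
    finally have "\<bar>flip j z - flip j y'\<bar> / max_flip j \<le> ?S z y / (2 * d)"
      using F by (simp add: field_simps)
    also have "\<dots> \<le> (hamming z z' + ?S y z') / (2 * d)"
    proof (intro divide_right_mono)
      \<comment> \<open>Triangle inequality through \<open>z'\<close>: the part between
        \<open>y\<close> and \<open>z'\<close> will be small in expectation, because the exact
        backward move rarely flips.\<close>
      have "?S z y \<le> ?S z z' + ?S y z'"
        unfolding sum.distrib[symmetric] by (intro sum_mono) auto
      also have "?S z z' \<le> hamming z z'"
        unfolding hamming_def by (intro sum_mono2) auto
      finally show "?S z y \<le> hamming z z' + ?S y z'" by simp
    qed (use d_ge_1 in auto)
    finally have "\<bar>flip j z - flip j y'\<bar> / max_flip j \<le> (hamming z z' + ?S y z') / (2 * d)" .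
    moreover have "\<bar>sigmoid (2 * (z $ j / \<eta> + s z $ j)) - sigmoid (2 * (z' $ j / \<eta> + s y $ j))\<bar> =
        \<bar>flip j z - flip j y'\<bar>"
      unfolding g g' using True by (simp add: abs_minus_commute)
    ultimately show ?thesis using True by (simp only: refl if_True)
  next
    case False
    have "flip j z + flip j y' \<le> 1"
      using flip_le_bound[OF z, of j] flip_le_bound[OF y', of j] flip_bound_le_half by linarith
    then have "\<bar>sigmoid (2 * (z $ j / \<eta> + s z $ j)) - sigmoid (2 * (z' $ j / \<eta> + s y $ j))\<bar> =
        1 - (flip j z + flip j y')"
      unfolding g g' using False hypercube_cases[OF z, of j] hypercube_cases[OF z', of j] by auto
    moreover have "max_flip j * ((d + 1) / (2 * d)) \<le> flip j z + flip j y'"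
    proof -
      obtain m where m: "m \<in> hypercube" "max_flip j = flip j m" using max_flip_attained by blast
      \<comment> \<open>The two signs at \<open>j\<close> are opposite, so a maximizer
        \<open>m\<close> of \<open>flip j\<close> shares its sign with one of the points. The flip
        there is then comparable with the maximum.\<close>
      have "m $ j = z $ j \<or> m $ j = y' $ j"
        using False hypercube_cases[OF z, of j] hypercube_cases[OF z', of j]
          hypercube_cases[OF m(1), of j] by (auto simp: y'_def)
      then have "flip j m * ((d + 1) / (2 * d)) \<le> flip j z \<or> flip j m * ((d + 1) / (2 * d)) \<le> flip j y'"
        using flip_ge_mult_flip m z y' by blast
      moreover have "0 \<le> flip j z" "0 \<le> flip j y'"
        using sigmoid_pos by (auto simp: flip_def intro: less_imp_le)
      ultimately show ?thesis unfolding m(2) by linarith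
    qed
    ultimately have "\<bar>sigmoid (2 * (z $ j / \<eta> + s z $ j)) - sigmoid (2 * (z' $ j / \<eta> + s y $ j))\<bar> / max_flip j
        \<le> (1 - max_flip j * ((d + 1) / (2 * d))) / max_flip j"
      using F by (intro divide_right_mono) auto
    also have "\<dots> = 1 / max_flip j - (d + 1) / (2 * d)" using F by (simp add: diff_divide_distrib)
    finally show ?thesis using False by simp
  qed
qed

text \<open>Resampling coordinate \<open>k\<close> once more does not change the law, and
  conditionally on the other coordinates it disagrees with \<open>z\<close> with probability at most
  \<open>flip_bound\<close>.\<close>

lemma prox_flip_le:
  assumes z: "z \<in> hypercube"
  shows "measure_pmf.expectation (prox \<eta> p z) (\<lambda>y. of_bool (y $ k \<noteq> z $ k)) \<le> flip_bound"
proof -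
  let ?h = "\<lambda>x. ln (pmf p x) + (z \<bullet> x) / \<eta>"
  let ?f = "\<lambda>y. of_bool (y $ k \<noteq> z $ k) :: real"
  have fin: "finite (set_pmf (gibbs_pmf ?h))" by (simp add: set_pmf_gibbs_pmf finite_hypercube)
  have "measure_pmf.expectation (prox \<eta> p z) ?f =
      measure_pmf.expectation (bind_pmf (gibbs_pmf ?h) (resample ?h k)) ?f"
    by (simp add: bind_gibbs_resample prox_def)
  also have "\<dots> = measure_pmf.expectation (gibbs_pmf ?h)
      (\<lambda>y. measure_pmf.expectation (resample ?h k y) ?f)"
    by (rule expectation_bind_finite[OF fin]) (simp add: resample_def)
  also have "\<dots> \<le> measure_pmf.expectation (gibbs_pmf ?h) (\<lambda>_. flip_bound)"
  proof (rule expectation_mono_finite[OF fin])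
    fix y assume "y \<in> set_pmf (gibbs_pmf ?h)"
    then have y: "y \<in> hypercube" by (simp add: set_pmf_gibbs_pmf)
    have y': "set_coord k (z $ k) y \<in> hypercube"
      using y hypercube_cases[OF z, of k] by (intro set_coord_hypercube) auto
    have "measure_pmf.expectation (resample ?h k y) ?f = flip k (set_coord k (z $ k) y)"
      using hypercube_cases[OF z, of k] cond_prob_bounds[of ?h k y]
        sigmoid_flip[OF y hypercube_cases[OF z], of k k]
      by (auto simp: resample_def cond_prob_prox)
    then show "measure_pmf.expectation (resample ?h k y) ?f \<le> flip_bound"
      using flip_le_bound[OF y'] by simp
  qed
  finally show ?thesis by simp
qed

text \<open>The sweep coupling is summed over the coordinates: each disagreement of \<open>z\<close>
  and \<open>z'\<close> gains \<open>(d + 1) / (2 * d)\<close>, while each agreement costs at most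
  an average influence of the other coordinates.\<close>

lemma backward_coupling:
  assumes z: "z \<in> hypercube" and z': "z' \<in> hypercube"
  shows "\<exists>c\<in>couplings (dups_v \<eta> s z) (prox \<eta> p z').
    measure_pmf.expectation c (\<lambda>(x, y). wdist x y) \<le>
      wdist z z' - hamming z z' / d + (d - 1) / 2 * flip_bound"
proof -
  let ?B = "\<lambda>j y. \<bar>sigmoid (2 * (z $ j / \<eta> + s z $ j)) - sigmoid (2 * (z' $ j / \<eta> + s y $ j))\<bar>"
  let ?D = "\<lambda>j (x, y). of_bool (x $ j \<noteq> y $ j) :: real"
  define l where "l = hamming z z'"
  \<comment> \<open>Bounds the expected number of coordinates other than \<open>j\<close> that the
    exact backward move flips.\<close>
  define K where "K = (d - 1) * flip_bound"
  have K: "K \<ge> 0" unfolding K_def using d_ge_1 flip_bound_nonneg by simp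
  obtain c where c: "c \<in> couplings (dups_v \<eta> s z) (prox \<eta> p z')"
    "\<And>j. measure_pmf.expectation c (?D j) \<le> measure_pmf.expectation (prox \<eta> p z') (?B j)"
    using gibbs_sweep_coupling[of "\<lambda>x. (z /\<^sub>R \<eta> + s z) \<bullet> x" "\<lambda>x. ln (pmf p x) + (z' \<bullet> x) / \<eta>" ?B]
    unfolding cond_prob_dups_v cond_prob_prox dups_v_def prox_def by blast
  have finv: "finite (set_pmf (prox \<eta> p z'))" and finu: "finite (set_pmf (dups_v \<eta> s z))"
    by (simp_all add: prox_def dups_v_def set_pmf_gibbs_pmf finite_hypercube)
  have finc: "finite (set_pmf c)" by (rule finite_set_pmf_coupling[OF c(1) finu finv])
  have supp: "y \<in> hypercube" if "y \<in> set_pmf (prox \<eta> p z')" for y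
    using that by (simp add: prox_def set_pmf_gibbs_pmf)
  have term_le: "measure_pmf.expectation c (?D j) / max_flip j \<le>
      of_bool (z $ j \<noteq> z' $ j) / max_flip j - of_bool (z $ j \<noteq> z' $ j) * ((d + 1) / (2 * d)) +
      (1 - of_bool (z $ j \<noteq> z' $ j)) * ((l + K) / (2 * d))" for j
  proof -
    have 1: "measure_pmf.expectation c (?D j) / max_flip j \<le>
        measure_pmf.expectation (prox \<eta> p z') (\<lambda>y. ?B j y / max_flip j)"
      using c(2)[of j] max_flip_pos[of j] by (simp add: divide_right_mono)
    show ?thesis
    proof (cases "z $ j = z' $ j")
      case True
      let ?S = "\<lambda>y. \<Sum>k\<in>UNIV - {j}. of_bool (y $ k \<noteq> z' $ k) :: real"
      have "measure_pmf.expectation (prox \<eta> p z') (\<lambda>y. ?B j y / max_flip j) \<le>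
          measure_pmf.expectation (prox \<eta> p z') (\<lambda>y. (l + ?S y) / (2 * d))"
        using cond_prob_diff_le[OF z z' supp, of _ j] True
        by (intro expectation_mono_finite finv) (auto simp: l_def)
      also have "\<dots> = (l + measure_pmf.expectation (prox \<eta> p z') ?S) / (2 * d)"
        by (simp add: integrable_measure_pmf_finite[OF finv])
      also have "\<dots> \<le> (l + K) / (2 * d)"
      proof (intro divide_right_mono add_left_mono)
        have "measure_pmf.expectation (prox \<eta> p z') ?S =
            (\<Sum>k\<in>UNIV - {j}. measure_pmf.expectation (prox \<eta> p z') (\<lambda>y. of_bool (y $ k \<noteq> z' $ k)))"
          by (rule expectation_sum_finite[OF finv])
        also have "\<dots> \<le> (\<Sum>k\<in>UNIV - {j}. flip_bound)"
          by (intro sum_mono prox_flip_le z')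
        also have "\<dots> = K" using d_ge_1 by (simp add: K_def card_Diff_singleton d_def)
        finally show "measure_pmf.expectation (prox \<eta> p z') ?S \<le> K" .
      qed (use d_ge_1 in auto)
      finally show ?thesis using 1 True by simp
    next
      case False
      have "measure_pmf.expectation (prox \<eta> p z') (\<lambda>y. ?B j y / max_flip j) \<le>
          measure_pmf.expectation (prox \<eta> p z') (\<lambda>_. 1 / max_flip j - (d + 1) / (2 * d))"
        using cond_prob_diff_le[OF z z' supp, of _ j] False
        by (intro expectation_mono_finite finv) auto
      then show ?thesis using 1 False by simp
    qed
  qed
  have "measure_pmf.expectation c (\<lambda>(x, y). wdist x y) =
      measure_pmf.expectation c (\<lambda>w. \<Sum>j\<in>UNIV. ?D j w / max_flip j)"
    by (simp add: wdist_def case_prod_unfold)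
  also have "\<dots> = (\<Sum>j\<in>UNIV. measure_pmf.expectation c (?D j) / max_flip j)"
    by (subst expectation_sum_finite[OF finc]) simp
  also have "\<dots> \<le> (\<Sum>j\<in>UNIV. of_bool (z $ j \<noteq> z' $ j) / max_flip j -
      of_bool (z $ j \<noteq> z' $ j) * ((d + 1) / (2 * d)) +
      (1 - of_bool (z $ j \<noteq> z' $ j)) * ((l + K) / (2 * d)))"
    by (intro sum_mono term_le)
  also have "\<dots> = wdist z z' - l * ((d + 1) / (2 * d)) + (d - l) * ((l + K) / (2 * d))"
    by (simp only: sum.distrib sum_subtractf sum_distrib_right[symmetric] wdist_def l_def hamming_def
        sum_constant d_def) simp
  also have "\<dots> \<le> wdist z z' - l / d + K / 2"
  proof -
    \<comment> \<open>\<open>l\<close> counts coordinates, and an integer is at most its square.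
      This turns the quadratic gain into one linear in \<open>l\<close>.\<close>
    have l2: "l \<le> l * l" and l0: "0 \<le> l"
    proof -
      have "l = real (card {i. z $ i \<noteq> z' $ i})"
        by (simp add: l_def hamming_def sum.If_cases of_bool_def)
      then show "l \<le> l * l" "0 \<le> l"
        by (metis le_square of_nat_le_iff of_nat_mult, simp)
    qed
    have "- (l * ((d + 1) / (2 * d))) + (d - l) * ((l + K) / (2 * d)) =
        (- l - l * l + d * K - l * K) / (2 * d)"
      using d_ge_1 by (simp add: field_simps)
    also have "\<dots> \<le> (- 2 * l + d * K) / (2 * d)"
    proof (rule divide_right_mono)
      show "- l - l * l + d * K - l * K \<le> - 2 * l + d * K"
        using l2 mult_nonneg_nonneg[OF l0 K] by linarith
    qed (use d_ge_1 in simp)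
    also have "\<dots> = - l / d + K / 2" using d_ge_1 by (simp add: field_simps)
    finally show ?thesis by simp
  qed
  finally show ?thesis using c(1) by (auto simp: l_def K_def)
qed

lemma wdist_vmul:
  assumes "e \<in> hypercube"
  shows "wdist (vmul x e) (vmul y e) = wdist x y" "hamming (vmul x e) (vmul y e) = hamming x y"
proof -
  have "vmul x e $ j \<noteq> vmul y e $ j \<longleftrightarrow> x $ j \<noteq> y $ j" for j
    using hypercube_cases[OF assms, of j] by auto
  then show "wdist (vmul x e) (vmul y e) = wdist x y" "hamming (vmul x e) (vmul y e) = hamming x y"
    by (simp_all only: wdist_def hamming_def)
qed

text \<open>Both chains use the same random signs \<open>e\<close> in the forward move, which
  preserves \<open>wdist\<close> and \<open>hamming\<close>; the backward coupling then does the
  rest.\<close>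

lemma step_coupling:
  assumes x: "x \<in> hypercube" and y: "y \<in> hypercube"
  shows "\<exists>c\<in>couplings (dups \<eta> s x) (bind_pmf (dups_u \<eta> y) (prox \<eta> p)).
    measure_pmf.expectation c (\<lambda>(x, y). wdist x y) \<le>
      wdist x y - hamming x y / d + (d - 1) / 2 * flip_bound"
proof -
  let ?b = "wdist x y - hamming x y / d + (d - 1) / 2 * flip_bound"
  let ?u = "dups_u \<eta> (\<chi> i. 1) :: (real ^ 'd) pmf"
  have u: "set_pmf ?u = hypercube" by (simp add: dups_u_def set_pmf_gibbs_pmf)
  have "\<forall>e\<in>hypercube. \<exists>k. k \<in> couplings (dups_v \<eta> s (vmul x e)) (prox \<eta> p (vmul y e)) \<and>
      measure_pmf.expectation k (\<lambda>(x, y). wdist x y) \<le> ?b"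
    using backward_coupling[OF vmul_hypercube[OF x] vmul_hypercube[OF y]] by (fastforce simp: wdist_vmul)
  then obtain k where k: "\<And>e. e \<in> hypercube \<Longrightarrow> k e \<in> couplings (dups_v \<eta> s (vmul x e)) (prox \<eta> p (vmul y e))"
      "\<And>e. e \<in> hypercube \<Longrightarrow> measure_pmf.expectation (k e) (\<lambda>(x, y). wdist x y) \<le> ?b"
    by metis
  let ?diag = "map_pmf (\<lambda>e. (e, e)) ?u"
  have diag: "?diag \<in> couplings ?u ?u" by (simp add: couplings_def map_pmf_comp)
  have "bind_pmf ?diag (\<lambda>w. k (fst w)) \<in>
      couplings (bind_pmf ?u (\<lambda>e. dups_v \<eta> s (vmul x e))) (bind_pmf ?u (\<lambda>e. prox \<eta> p (vmul y e)))"
    by (rule bind_pmf_couplings[OF diag]) (use k(1) u in auto)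
  then have mem: "bind_pmf ?u k \<in> couplings (dups \<eta> s x) (bind_pmf (dups_u \<eta> y) (prox \<eta> p))"
    by (simp add: dups_def dups_u_vmul[OF x] dups_u_vmul[OF y] bind_map_pmf)
  have "finite (set_pmf (k e))" if "e \<in> hypercube" for e
    by (rule finite_set_pmf_coupling[OF k(1)[OF that]])
      (simp_all add: dups_v_def prox_def set_pmf_gibbs_pmf finite_hypercube)
  then have "measure_pmf.expectation (bind_pmf ?u k) (\<lambda>(x, y). wdist x y) =
      measure_pmf.expectation ?u (\<lambda>e. measure_pmf.expectation (k e) (\<lambda>(x, y). wdist x y))"
    by (intro expectation_bind_finite) (auto simp: u finite_hypercube)
  also have "\<dots> \<le> measure_pmf.expectation ?u (\<lambda>_. ?b)"
    by (rule expectation_mono_finite) (simp_all only: u finite_hypercube k(2))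
  finally show ?thesis using mem by auto
qed

section \<open>Comparison of the invariant laws\<close>

lemma wdist_nonneg: "0 \<le> wdist x y"
  unfolding wdist_def using max_flip_pos by (intro sum_nonneg divide_nonneg_pos) auto

text \<open>If the bound failed, a joint step would lower the expected \<open>wdist\<close> of every
  coupling by at least a fixed \<open>\<Delta> > 0\<close>. This contradicts the definition of the
  infimum over couplings, whether or not it is attained.\<close>

lemma wasserstein_invariant_le:
  assumes q: "set_pmf q \<subseteq> hypercube" and inv: "bind_pmf q (dups \<eta> s) = q"
  shows "wasserstein q p \<le> d * ((d - 1) / 2 * flip_bound)"
proof (rule ccontr)
  assume neg: "\<not> ?thesis"
  let ?b = "(d - 1) / 2 * flip_bound"
  let ?E = "\<lambda>c. measure_pmf.expectation c (\<lambda>(x, y). wdist x y)"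
  define \<Delta> where "\<Delta> = wasserstein q p / d - ?b"
  have \<Delta>: "\<Delta> > 0" unfolding \<Delta>_def using neg d_ge_1 by (simp add: field_simps)
  have bdd: "bdd_below (?E ` couplings q p)"
    by (rule bdd_belowI2[where m = 0]) (auto intro!: Bochner_Integration.integral_nonneg simp: wdist_nonneg)
  have bddh: "bdd_below ((\<lambda>c. measure_pmf.expectation c (\<lambda>(x, y). hamming x y)) ` couplings q p)"
    by (rule bdd_belowI2[where m = 0]) (auto intro!: Bochner_Integration.integral_nonneg simp: hamming_nonneg)
  have "(INF c\<in>couplings q p. ?E c) + \<Delta> \<le> ?E c" if c: "c \<in> couplings q p" for c
  proof -
    have finc: "finite (set_pmf c)"
      by (rule finite_set_pmf_coupling[OF c])
        (use q p_pos finite_hypercube in \<open>auto intro: finite_subset\<close>)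
    have cH: "x \<in> hypercube \<and> y \<in> hypercube" if "(x, y) \<in> set_pmf c" for x y
      using set_pmf_coupling[OF c] that q p_pos by auto
    have "\<forall>w\<in>set_pmf c. \<exists>k.
        k \<in> couplings (dups \<eta> s (fst w)) (bind_pmf (dups_u \<eta> (snd w)) (prox \<eta> p)) \<and>
        ?E k \<le> wdist (fst w) (snd w) - hamming (fst w) (snd w) / d + ?b"
      using step_coupling cH by (metis prod.collapse)
    then obtain k where k: "\<And>w. w \<in> set_pmf c \<Longrightarrow>
        k w \<in> couplings (dups \<eta> s (fst w)) (bind_pmf (dups_u \<eta> (snd w)) (prox \<eta> p))"
      "\<And>w. w \<in> set_pmf c \<Longrightarrow> ?E (k w) \<le> wdist (fst w) (snd w) - hamming (fst w) (snd w) / d + ?b"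
      by metis
    have "bind_pmf c k \<in> couplings (bind_pmf q (dups \<eta> s))
        (bind_pmf p (\<lambda>y. bind_pmf (dups_u \<eta> y) (prox \<eta> p)))"
      by (rule bind_pmf_couplings[OF c]) (use k(1) in force)
    \<comment> \<open>Each law is invariant for its own kernel, so the joint step again couples
      \<open>q\<close> with \<open>p\<close>.\<close>
    then have mem: "bind_pmf c k \<in> couplings q p"
      by (simp add: inv bind_prox_invariant[OF p_pos])
    have "(INF c\<in>couplings q p. ?E c) \<le> ?E (bind_pmf c k)"
      by (rule cINF_lower[OF bdd mem])
    also have "\<dots> = measure_pmf.expectation c (\<lambda>w. ?E (k w))"
      by (intro expectation_bind_finite finc finite_set_pmf_coupling[OF k(1)])
        (auto simp: dups_def dups_u_def dups_v_def prox_def set_pmf_gibbs_pmf finite_hypercube)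
    also have "\<dots> \<le> measure_pmf.expectation c
        (\<lambda>w. wdist (fst w) (snd w) - hamming (fst w) (snd w) / d + ?b)"
      by (intro expectation_mono_finite finc k(2))
    also have "\<dots> = ?E c - measure_pmf.expectation c (\<lambda>(x, y). hamming x y) / d + ?b"
      by (simp add: integrable_measure_pmf_finite[OF finc] case_prod_unfold)
    also have "\<dots> \<le> ?E c - \<Delta>"
    proof -
      \<comment> \<open>The expected Hamming distance of any coupling is at least the Wasserstein
        distance, which makes the decrease uniform in \<open>c\<close>.\<close>
      have "wasserstein q p \<le> measure_pmf.expectation c (\<lambda>(x, y). hamming x y)"
        unfolding wasserstein_def by (rule cINF_lower[OF bddh c])
      then have "wasserstein q p / d \<le> measure_pmf.expectation c (\<lambda>(x, y). hamming x y) / d"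
        using d_ge_1 by (intro divide_right_mono) auto
      then show ?thesis by (simp add: \<Delta>_def)
    qed
    finally show ?thesis by simp
  qed
  then have "(INF c\<in>couplings q p. ?E c) + \<Delta> \<le> (INF c\<in>couplings q p. ?E c)"
    using pair_pmf_couplings by (intro cINF_greatest) auto
  then show False using \<Delta> by simp
qed

end

theorem theorem7:
  fixes p :: "(real ^ 'd) pmf" and s :: "real ^ 'd \<Rightarrow> real ^ 'd" and \<eta> :: real
  assumes "set_pmf p = hypercube"
    and "s = glauber_score p"
    and "\<eta> > 0"
    and "\<And>x i. x \<in> hypercube \<Longrightarrow> x $ i * s x $ i \<ge> - 1 / (2 * \<eta>)"
    and "8 * real CARD('d) * score_beta2 s \<le> 1"
  shows "\<exists>p_hat.
      (\<forall>q. invariant_pmf (dups \<eta> s) q \<longleftrightarrow> q = p_hat) \<and>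
      (\<forall>x\<in>hypercube. \<forall>y\<in>hypercube.
        (\<lambda>n. pmf (kernel_power (dups \<eta> s) n x) y) \<longlonglongrightarrow> pmf p_hat y) \<and>
      wasserstein p_hat p \<le>
        real CARD('d) ^ 3 / 2 * (1 + exp (- 1 / \<eta>)) ^ (CARD('d) - 1) * exp (- 1 / \<eta>)"
proof -
  define d where "d = real CARD('d)"
  interpret proximal_sampler p s \<eta> d by standard (use assms d_def in auto)
  \<comment> \<open>Gibbs measures charge the whole hypercube, so one DUPS step reaches every
    state.\<close>
  have "set_pmf (dups \<eta> s x) = hypercube" if "x \<in> hypercube" for x
    by (auto simp: dups_def dups_u_def dups_v_def set_pmf_gibbs_pmf hypercube_not_empty)
  then have "\<exists>\<pi>. (\<forall>q. set_pmf q \<subseteq> hypercube \<and> bind_pmf q (dups \<eta> s) = q \<longleftrightarrow> q = \<pi>) \<and>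
    (\<forall>x\<in>hypercube. \<forall>y\<in>hypercube.
      (\<lambda>n. pmf (kernel_power (dups \<eta> s) n x) y) \<longlonglongrightarrow> pmf \<pi> y)"
    by (rule positive_kernel_converges[OF finite_hypercube hypercube_not_empty])
  then obtain p_hat where p_hat:
    "\<And>q. set_pmf q \<subseteq> hypercube \<and> bind_pmf q (dups \<eta> s) = q \<longleftrightarrow> q = p_hat"
    "\<forall>x\<in>hypercube. \<forall>y\<in>hypercube.
      (\<lambda>n. pmf (kernel_power (dups \<eta> s) n x) y) \<longlonglongrightarrow> pmf p_hat y"
    by blast
  have "wasserstein p_hat p \<le> d * ((d - 1) / 2 * flip_bound)"
    using p_hat(1)[of p_hat] by (intro wasserstein_invariant_le) auto
  also have "\<dots> = (d * (d - 1) / 2) * flip_bound" by simp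
  also have "\<dots> \<le> (d ^ 3 / 2 * (1 + exp (- 1 / \<eta>)) ^ (CARD('d) - 1)) * exp (- 1 / \<eta>)"
  proof (intro mult_mono flip_bound_le_exp flip_bound_nonneg)
    \<comment> \<open>Passing to the stated constant uses \<open>d - 1 \<le> d\<^sup>2\<close> and
      the fact that the power of \<open>1 + exp (- 1 / \<eta>)\<close> is at least 1.\<close>
    have "d * (d - 1) / 2 \<le> d * d\<^sup>2 / 2"
      using d_ge_1 self_le_power[of d 2] by (intro divide_right_mono mult_left_mono) auto
    also have "\<dots> = d ^ 3 / 2 * 1" by (simp add: power_numeral_reduce)
    also have "\<dots> \<le> d ^ 3 / 2 * (1 + exp (- 1 / \<eta>)) ^ (CARD('d) - 1)"
      using d_ge_1 by (intro mult_left_mono one_le_power) auto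
    finally show "d * (d - 1) / 2 \<le> d ^ 3 / 2 * (1 + exp (- 1 / \<eta>)) ^ (CARD('d) - 1)" .
  qed (use d_ge_1 in auto)
  finally show ?thesis
    using p_hat unfolding invariant_pmf_def d_def by blast
qed

end
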